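(* Let $H$ be a $d$-regular, reflective, connected bipartite graph which satisfies Sidorenko's conjecture and which is not $K_{d,d}$. Then there are $\varepsilon=\varepsilon(H)>0$ and a constant $C>0$ such that $\mathrm{ex}(n,H)\leq Cn^{2-1/d-\varepsilon}$ for all positive integers $n$.
   Context: $\mathrm{ex}(n,H)$ is the maximum number of edges in an $n$-vertex graph with no subgraph isomorphic to $H$. An $n$-vertex graph has edge density $p$ if it has $pn^2/2$ edges. A homomorphism $H\to G$ is a map $V(H)\to V(G)$ sending edges to edges; $\hom(H,G)$ is their number. $H$ satisfies Sidorenko's conjecture if $\hom(H,G)\geq n^{v(H)}p^{e(H)}$ for every $n$-vertex graph $G$ of edge density $p$. For an automorphism $\phi$ of $H$ let $F_\phi=\{v\in V(H):\phi(v)=v\}$. For a connected bipartite graph $H$, a triple $(A,B,\phi)$ with $A,B\subset V(H)$ and $\phi$ an automorphism of $H$ is nice if $\phi=\phi^{-1}$; $A$, $B$, $F_\phi$ partition $V(H)$; $F_\phi$ separates $A$ from $B$ (no edge of $H$ joins $A$ and $B$); and $\phi(A)=B$. A set $R\subset V(H)$ is admissible for $(A,B,\phi)$ if all vertices of $R$ lie in the same part of the bipartition of $H$ and $R$ intersects both $A\cup F_\phi$ and $B\cup F_\phi$. Define $\psi_{A,B,\phi}(R)=(R\cap(A\cup F_\phi))\cup\phi(R\cap A)$. A connected bipartite graph $H$ with parts $X_1,X_2$ is reflective if for every $i\in\{1,2\}$ and every $R\subset X_i$ with $|R|=2$ there exist nice triples $(A_j,B_j,\phi_j)$, $j=0,\dots,m-1$,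 and sets $R_0,\dots,R_m$ with $R_j$ admissible for $(A_j,B_j,\phi_j)$, $R_0=R$, $R_m=X_i$ and $R_{j+1}=\psi_{A_j,B_j,\phi_j}(R_j)$ for all $0\leq j\leq m-1$. *)

theory Defs
  imports Complex_Main "HOL-Library.FuncSet"
begin

record 'a graph =
  verts :: "'a set"
  edges :: "'a set set"

definition simple_graph :: "'a graph \<Rightarrow> bool" where
  "simple_graph G \<longleftrightarrow> finite (verts G) \<and> (\<forall>e\<in>edges G. e \<subseteq> verts G \<and> card e = 2)"

definition connected_graph :: "'a graph \<Rightarrow> bool" where
  "connected_graph G \<longleftrightarrow> verts G \<noteq> {} \<and>
     (\<forall>u\<in>verts G. \<forall>v\<in>verts G. (u, v) \<in> {(x, y). {x, y} \<in> edges G}\<^sup>*)"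

definition regular_graph :: "'a graph \<Rightarrow> nat \<Rightarrow> bool" where
  "regular_graph G d \<longleftrightarrow> (\<forall>v\<in>verts G. card {u. {u, v} \<in> edges G} = d)"

definition bipartition :: "'a graph \<Rightarrow> 'a set \<Rightarrow> 'a set \<Rightarrow> bool" where
  "bipartition G X\<^sub>1 X\<^sub>2 \<longleftrightarrow> X\<^sub>1 \<union> X\<^sub>2 = verts G \<and> X\<^sub>1 \<inter> X\<^sub>2 = {} \<and>
     (\<forall>e\<in>edges G. \<exists>x\<in>X\<^sub>1. \<exists>y\<in>X\<^sub>2. e = {x, y})"

definition complete_bipartite :: "nat \<Rightarrow> nat \<Rightarrow> (nat + nat) graph" where
  "complete_bipartite s t =
     \<lparr>verts = {..<s} <+> {..<t}, edges = {{Inl i, Inr j} | i j. i < s \<and> j < t}\<rparr>"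

definition is_graph_iso :: "'a graph \<Rightarrow> 'b graph \<Rightarrow> ('a \<Rightarrow> 'b) \<Rightarrow> bool" where
  "is_graph_iso G H f \<longleftrightarrow> bij_betw f (verts G) (verts H) \<and>
     (\<forall>u\<in>verts G. \<forall>v\<in>verts G. {u, v} \<in> edges G \<longleftrightarrow> {f u, f v} \<in> edges H)"

definition isomorphic :: "'a graph \<Rightarrow> 'b graph \<Rightarrow> bool" where
  "isomorphic G H \<longleftrightarrow> (\<exists>f. is_graph_iso G H f)"

definition subgraph :: "'a graph \<Rightarrow> 'a graph \<Rightarrow> bool" where
  "subgraph F G \<longleftrightarrow> simple_graph F \<and> verts F \<subseteq> verts G \<and> edges F \<subseteq> edges G"

(* The n-vertex host graphs range over finite vertex sets of natural numbers, which covers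
   every n-vertex graph up to isomorphism.  If H has an edge, the edgeless graph shows that
   the set is nonempty; Max is then a genuine maximum. *)
definition turan_ex :: "nat \<Rightarrow> 'a graph \<Rightarrow> nat" where
  "turan_ex n H = Max {card (edges G) | G :: nat graph.
     simple_graph G \<and> card (verts G) = n \<and> \<not> (\<exists>F. subgraph F G \<and> isomorphic F H)}"

definition edge_density :: "'a graph \<Rightarrow> real \<Rightarrow> bool" where
  "edge_density G p \<longleftrightarrow> real (card (edges G)) = p * real (card (verts G)) ^ 2 / 2"

definition homs :: "'a graph \<Rightarrow> 'b graph \<Rightarrow> ('a \<Rightarrow> 'b) set" where
  "homs H G = {f \<in> verts H \<rightarrow>\<^sub>E verts G. \<forall>e\<in>edges H. f ` e \<in> edges G}"

definition sidorenko :: "'a graph \<Rightarrow> bool" where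
  "sidorenko H \<longleftrightarrow> (\<forall>(G :: nat graph) p. simple_graph G \<longrightarrow> edge_density G p \<longrightarrow>
     real (card (homs H G)) \<ge> real (card (verts G)) ^ card (verts H) * p ^ card (edges H))"

definition fixed_verts :: "'a graph \<Rightarrow> ('a \<Rightarrow> 'a) \<Rightarrow> 'a set" where
  "fixed_verts H \<phi> = {v \<in> verts H. \<phi> v = v}"

(* An automorphism is a total function of which only the values on the vertices matter, so
   the involution condition is imposed there. *)
definition nice :: "'a graph \<Rightarrow> 'a set \<Rightarrow> 'a set \<Rightarrow> ('a \<Rightarrow> 'a) \<Rightarrow> bool" where
  "nice H A B \<phi> \<longleftrightarrow>
     is_graph_iso H H \<phi> \<and> (\<forall>v\<in>verts H. \<phi> (\<phi> v) = v) \<and>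
     A \<union> B \<union> fixed_verts H \<phi> = verts H \<and>
     A \<inter> B = {} \<and> A \<inter> fixed_verts H \<phi> = {} \<and> B \<inter> fixed_verts H \<phi> = {} \<and>
     (\<forall>a\<in>A. \<forall>b\<in>B. {a, b} \<notin> edges H) \<and>
     \<phi> ` A = B"

definition admissible ::
  "'a graph \<Rightarrow> 'a set \<Rightarrow> 'a set \<Rightarrow> 'a set \<Rightarrow> 'a set \<Rightarrow> ('a \<Rightarrow> 'a) \<Rightarrow> 'a set \<Rightarrow> bool" where
  "admissible H X\<^sub>1 X\<^sub>2 A B \<phi> R \<longleftrightarrow> (R \<subseteq> X\<^sub>1 \<or> R \<subseteq> X\<^sub>2) \<and>
     R \<inter> (A \<union> fixed_verts H \<phi>) \<noteq> {} \<and> R \<inter> (B \<union> fixed_verts H \<phi>) \<noteq> {}"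

definition psi :: "'a graph \<Rightarrow> 'a set \<Rightarrow> 'a set \<Rightarrow> ('a \<Rightarrow> 'a) \<Rightarrow> 'a set \<Rightarrow> 'a set" where
  "psi H A B \<phi> R = (R \<inter> (A \<union> fixed_verts H \<phi>)) \<union> \<phi> ` (R \<inter> A)"

(* For a connected bipartite graph H whose parts are X\<^sub>1 and X\<^sub>2. *)
definition reflective :: "'a graph \<Rightarrow> 'a set \<Rightarrow> 'a set \<Rightarrow> bool" where
  "reflective H X\<^sub>1 X\<^sub>2 \<longleftrightarrow> (\<forall>X\<in>{X\<^sub>1, X\<^sub>2}. \<forall>R. R \<subseteq> X \<and> card R = 2 \<longrightarrow>
     (\<exists>(m :: nat) A B \<phi> S. S 0 = R \<and> S m = X \<and>
        (\<forall>j<m. nice H (A j) (B j) (\<phi> j) \<and>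
               admissible H X\<^sub>1 X\<^sub>2 (A j) (B j) (\<phi> j) (S j) \<and>
               S (Suc j) = psi H (A j) (B j) (\<phi> j) (S j))))"

end

theory Submission
  imports Defs "HOL-Analysis.Convex" "HOL-Library.Nat_Bijection"
begin

text \<open>Let \<open>k\<close> be the common size of the two parts of \<open>H\<close>; since \<open>H\<close> is not
  \<open>K\<^sub>d\<^sub>,\<^sub>d\<close>, \<open>d < k\<close>. In a bipartite host \<open>G\<close> without a copy of \<open>H\<close> every homomorphism
  \<open>H \<rightarrow> G\<close> identifies two vertices of the same part, so for some pair \<open>R\<close> a positive proportion of
  the homomorphisms is constant on \<open>R\<close>. Cutting along the fixed set of a nice triple and applying
  Cauchy--Schwarz shows that a positive proportion is still constant on \<open>\<psi>(R)\<close>, hence, iterating, on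
  a whole part \<open>X\<^sub>i\<close>. The latter homomorphisms are stars, at most \<open>\<Sum> deg(v)\<^sup>k\<close> in number, which for
  an almost regular \<open>G\<close> contradicts the lower bound of Sidorenko's conjecture as soon as \<open>G\<close> has more
  than about \<open>n\<close> to the power \<open>2 - (k - 1) / ((d - 1) k)\<close> edges; this exponent is below
  \<open>2 - 1 / d\<close> exactly when \<open>d < k\<close>.\<close>

section \<open>Homomorphisms and reflections\<close>

text \<open>Reflections may be iterated because their number depends on \<open>H\<close> and the
  pair only: a proportion x of homomorphisms constant on \<open>R\<close> becomes at least x^2 on
  \<psi>(\<open>R\<close>), so it stays bounded below by a constant. The exponent comes from
  comparing, in a host of density p, n^(2k) p^(dk) homomorphisms with about n (pn)^k stars, which
  forces p^((d-1)k) to be at most of order n^(-(k-1)). Two obstacles shape the rest. A pair of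
  vertices from opposite parts of \<open>H\<close> cannot start a reflection sequence; a bipartite
  host keeps their images apart. And making the host almost regular may leave sides of very
  different sizes a and b, for which its density relative to (a + b)^2 is too small; blowing up the
  sides replaces it by e/(2ab) for e edges. With q = (d-1)k and a \<le> b, the resulting bound on
  e^q is (ab)^q / a^(k-1) up to constants and logarithms; it grows with both sides because q \<ge> k
  - 1, so the unknown sizes can be replaced by n.\<close>

lemma simple_graph_edgeE:
  assumes "simple_graph G" "e \<in> edges G"
  obtains u v where "e = {u, v}" "u \<noteq> v" "u \<in> verts G" "v \<in> verts G"
proof -
  have "card e = 2" "e \<subseteq> verts G"
    using assms by (auto simp: simple_graph_def)
  then show thesis
    using that by (auto simp: card_2_iff)
qed

lemma simple_graph_edgeD:
  assumes "simple_graph G" "{u, v} \<in> edges G"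
  shows "u \<noteq> v" "u \<in> verts G" "v \<in> verts G"
  using assms by (auto simp: simple_graph_def)

lemma finite_verts: "simple_graph G \<Longrightarrow> finite (verts G)"
  by (simp add: simple_graph_def)

lemma finite_edges: "simple_graph G \<Longrightarrow> finite (edges G)"
  by (auto simp: simple_graph_def intro: finite_subset[of _ "Pow (verts G)"])

lemma homs_iff:
  assumes "simple_graph H"
  shows "f \<in> homs H G \<longleftrightarrow> f \<in> verts H \<rightarrow>\<^sub>E verts G \<and>
           (\<forall>u v. {u, v} \<in> edges H \<longrightarrow> {f u, f v} \<in> edges G)"
proof
  assume f: "f \<in> homs H G"
  have "{f u, f v} \<in> edges G" if "{u, v} \<in> edges H" for u v
    using f that unfolding homs_def by force
  then show "f \<in> verts H \<rightarrow>\<^sub>E verts G \<and> (\<forall>u v. {u, v} \<in> edges H \<longrightarrow> {f u, f v} \<in> edges G)"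
    using f by (auto simp: homs_def)
next
  assume *: "f \<in> verts H \<rightarrow>\<^sub>E verts G \<and> (\<forall>u v. {u, v} \<in> edges H \<longrightarrow> {f u, f v} \<in> edges G)"
  have "f ` e \<in> edges G" if "e \<in> edges H" for e
    using assms that * by (elim simple_graph_edgeE) auto
  then show "f \<in> homs H G"
    using * by (auto simp: homs_def)
qed

lemma finite_homs: "simple_graph H \<Longrightarrow> simple_graph G \<Longrightarrow> finite (homs H G)"
  unfolding homs_def
  by (rule finite_subset[of _ "verts H \<rightarrow>\<^sub>E verts G"]) (auto simp: finite_PiE finite_verts)

section \<open>Homomorphisms constant on a set, and gluing along a fixed set\<close>

definition homs_const :: "'a graph \<Rightarrow> 'b graph \<Rightarrow> 'a set \<Rightarrow> ('a \<Rightarrow> 'b) set" where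
  "homs_const H G R = {f \<in> homs H G. \<forall>u\<in>R. \<forall>v\<in>R. f u = f v}"

lemma homs_const_subset: "homs_const H G R \<subseteq> homs H G"
  by (auto simp: homs_const_def)

lemma homs_const_antimono: "R \<subseteq> R' \<Longrightarrow> homs_const H G R' \<subseteq> homs_const H G R"
  by (auto simp: homs_const_def)

lemma finite_homs_const: "simple_graph H \<Longrightarrow> simple_graph G \<Longrightarrow> finite (homs_const H G R)"
  using finite_homs homs_const_subset finite_subset by metis

text \<open>\<open>\<kappa>\<close> prescribes the restriction to \<open>F\<close> and the common value on \<open>W\<close>. For a fixed \<open>\<kappa>\<close> the two
  halves of a homomorphism can be chosen independently.\<close>

definition half_homs ::
  "'a graph \<Rightarrow> 'b graph \<Rightarrow> 'a set \<Rightarrow> 'a set \<Rightarrow> 'a set \<Rightarrow> ('a \<Rightarrow> 'b) \<times> 'b \<Rightarrow> ('a \<Rightarrow> 'b) set" where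
  "half_homs H G D F W \<kappa> = {p \<in> D \<rightarrow>\<^sub>E verts G.
     (\<forall>u\<in>D. \<forall>v\<in>D. {u, v} \<in> edges H \<longrightarrow> {p u, p v} \<in> edges G) \<and>
     restrict p F = fst \<kappa> \<and> (\<forall>u\<in>W. p u = snd \<kappa>)}"

lemma niceD:
  assumes "nice H A B \<phi>"
  shows "v \<in> verts H \<Longrightarrow> \<phi> v \<in> verts H"
    and "v \<in> verts H \<Longrightarrow> \<phi> (\<phi> v) = v"
    and "A \<subseteq> verts H" and "B \<subseteq> verts H"
    and "v \<in> A \<Longrightarrow> \<phi> v \<in> B" and "v \<in> B \<Longrightarrow> \<phi> v \<in> A"
    and "v \<in> verts H \<Longrightarrow> v \<in> A \<or> v \<in> B \<or> v \<in> fixed_verts H \<phi>"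
    and "u \<in> verts H \<Longrightarrow> v \<in> verts H \<Longrightarrow> {\<phi> u, \<phi> v} \<in> edges H \<longleftrightarrow> {u, v} \<in> edges H"
    and "a \<in> A \<Longrightarrow> b \<in> B \<Longrightarrow> {a, b} \<notin> edges H"
    and "A \<inter> B = {}" and "A \<inter> fixed_verts H \<phi> = {}" and "B \<inter> fixed_verts H \<phi> = {}"
    and "v \<in> fixed_verts H \<phi> \<Longrightarrow> \<phi> v = v" and "fixed_verts H \<phi> \<subseteq> verts H"
proof -
  have *: "A \<union> B \<union> fixed_verts H \<phi> = verts H" "\<phi> ` A = B" "\<phi> ` verts H = verts H"
    "\<forall>v\<in>verts H. \<phi> (\<phi> v) = v"
    "\<forall>u\<in>verts H. \<forall>v\<in>verts H. {u, v} \<in> edges H \<longleftrightarrow> {\<phi> u, \<phi> v} \<in> edges H"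
    using assms by (auto simp: nice_def is_graph_iso_def bij_betw_def)
  show "v \<in> verts H \<Longrightarrow> \<phi> v \<in> verts H" "v \<in> A \<Longrightarrow> \<phi> v \<in> B"
    using *(2,3) by auto
  show "v \<in> verts H \<Longrightarrow> \<phi> (\<phi> v) = v"
    "u \<in> verts H \<Longrightarrow> v \<in> verts H \<Longrightarrow> {\<phi> u, \<phi> v} \<in> edges H \<longleftrightarrow> {u, v} \<in> edges H"
    using *(4,5) by simp_all
  show "A \<subseteq> verts H" "B \<subseteq> verts H"
    "v \<in> verts H \<Longrightarrow> v \<in> A \<or> v \<in> B \<or> v \<in> fixed_verts H \<phi>"
    using *(1) by auto
  show "\<phi> v \<in> A" if v: "v \<in> B"
  proof -
    obtain a where a: "a \<in> A" "v = \<phi> a" using v *(2) by blast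
    then have "a \<in> verts H" using *(1) by auto
    then show ?thesis using a *(4) by simp
  qed
  show "a \<in> A \<Longrightarrow> b \<in> B \<Longrightarrow> {a, b} \<notin> edges H" "A \<inter> B = {}"
    "A \<inter> fixed_verts H \<phi> = {}" "B \<inter> fixed_verts H \<phi> = {}"
    "v \<in> fixed_verts H \<phi> \<Longrightarrow> \<phi> v = v" "fixed_verts H \<phi> \<subseteq> verts H"
    using assms by (auto simp: nice_def fixed_verts_def)
qed

text \<open>A square counts pairs (p, q) of halves with the same data \<kappa>. Such halves agree on
  the fixed set, and no edge joins \<open>A\<close> to \<open>B\<close>, so p on \<open>A\<close>
  and the mirror image of q on \<open>B\<close> glue to a homomorphism of all of \<open>H\<close>;
  it takes the value \<open>snd \<kappa>\<close> on \<open>W\<close> and on its mirror image. Both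
  the pair and \<kappa> can be recovered from the result.\<close>

lemma sum_half_homs_square_le:
  assumes H: "simple_graph H" and G: "simple_graph G" and nice: "nice H A B \<phi>"
    and W: "W \<noteq> {}" "W \<subseteq> A \<union> fixed_verts H \<phi>" and K: "finite K"
  shows "(\<Sum>\<kappa>\<in>K. card (half_homs H G (A \<union> fixed_verts H \<phi>) (fixed_verts H \<phi>) W \<kappa>) ^ 2)
           \<le> card (homs_const H G (W \<union> \<phi> ` W))"
proof -
  let ?F = "fixed_verts H \<phi>"
  let ?D = "A \<union> ?F"
  let ?\<gamma> = "half_homs H G ?D ?F W"
  note n = niceD[OF nice]
  define glue where "glue p q = (\<lambda>v\<in>verts H. if v \<in> ?D then p v else q (\<phi> v))"
    for p q :: "'a \<Rightarrow> 'b"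
  have finD: "finite ?D"
    using n(3,14) finite_verts[OF H] by (auto intro: finite_subset)
  have fin: "finite (?\<gamma> \<kappa>)" for \<kappa>
    unfolding half_homs_def
    by (rule finite_subset[of _ "?D \<rightarrow>\<^sub>E verts G"]) (use finD finite_verts[OF G] in \<open>auto simp: finite_PiE\<close>)
  have glue_D: "glue p q v = p v" if "v \<in> ?D" for p q v
    using that n(3,14) by (auto simp: glue_def)
  \<comment> \<open>For v in \<open>A\<close> this is the definition, as \<phi> v lies outside
    \<open>?D\<close> and \<phi> is an involution; on the fixed set it holds because p and q share
    \<open>fst \<kappa>\<close>.\<close>
  have glue_phi: "glue p q (\<phi> v) = q v"
    if "v \<in> ?D" "p \<in> ?\<gamma> \<kappa>" "q \<in> ?\<gamma> \<kappa>" for p q v \<kappa>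
  proof (cases "v \<in> ?F")
    case True
    have "restrict p ?F v = restrict q ?F v"
      using that by (simp add: half_homs_def)
    then show ?thesis
      using True n(13)[OF True] glue_D[of v] that by simp
  next
    case False
    then have v: "v \<in> A" "\<phi> v \<in> B" "\<phi> v \<notin> ?D" "\<phi> v \<in> verts H" "v \<in> verts H"
      using that n(3-5,10,12) by blast+
    then show ?thesis
      by (simp add: glue_def n(2))
  qed
  have B_D: "v \<in> ?D \<or> (\<phi> v \<in> ?D \<and> v \<in> B)" if "v \<in> verts H" for v
    using n(7)[OF that] n(6) by blast
  have glue_hom: "glue p q \<in> homs_const H G (W \<union> \<phi> ` W)"
    if p: "p \<in> ?\<gamma> \<kappa>" and q: "q \<in> ?\<gamma> \<kappa>" for p q \<kappa>
  proof -
    have pV: "p v \<in> verts G" "q v \<in> verts G" if "v \<in> ?D" for v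
      using p q that by (auto simp: half_homs_def)
    have ph: "{r u, r v} \<in> edges G" if "u \<in> ?D" "v \<in> ?D" "{u, v} \<in> edges H" "r = p \<or> r = q" for r u v
      using p q that by (auto simp: half_homs_def)
    have "glue p q \<in> verts H \<rightarrow>\<^sub>E verts G"
    proof (rule PiE_I)
      fix v assume "v \<in> verts H"
      then show "glue p q v \<in> verts G"
        using B_D[of v] pV[of v] pV[of "\<phi> v"] by (auto simp: glue_def)
    qed (simp add: glue_def)
    moreover have "{glue p q u, glue p q v} \<in> edges G" if e: "{u, v} \<in> edges H" for u v
    proof -
      have uv: "u \<in> verts H" "v \<in> verts H"
        using simple_graph_edgeD[OF H e] by auto
      have "{v, u} \<in> edges H"
        using e by (simp add: insert_commute)
      \<comment> \<open>No edge crosses from \<open>A\<close> to \<open>B\<close>, so every edge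
        lies inside \<open>?D\<close> or is carried there by \<phi>; in the second case q preserves
        the mirrored edge.\<close>
      then consider "u \<in> ?D" "v \<in> ?D" | "\<phi> u \<in> ?D" "\<phi> v \<in> ?D"
        using e B_D[OF uv(1)] B_D[OF uv(2)] n(9)[of u v] n(9)[of v u] n(13)[of u] n(13)[of v] by auto
      then show ?thesis
      proof cases
        case 1
        then show ?thesis
          using ph[of u v p] e by (simp add: glue_D)
      next
        case 2
        have "{\<phi> u, \<phi> v} \<in> edges H"
          using e n(8) uv by simp
        then have "{q (\<phi> u), q (\<phi> v)} \<in> edges G"
          using ph 2 by blast
        moreover have "glue p q u = q (\<phi> u)" "glue p q v = q (\<phi> v)"
          using glue_phi[OF 2(1) p q] glue_phi[OF 2(2) p q] n(2) uv by auto
        ultimately show ?thesis by simp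
      qed
    qed
    moreover have "glue p q u = snd \<kappa>" if u: "u \<in> W \<union> \<phi> ` W" for u
      using u
    proof
      assume "u \<in> W"
      then show ?thesis
        using W p by (subst glue_D) (auto simp: half_homs_def)
    next
      assume "u \<in> \<phi> ` W"
      then obtain w where w: "w \<in> W" "u = \<phi> w" by blast
      then have "glue p q u = q w"
        using glue_phi[OF _ p q] W by blast
      then show ?thesis
        using w q by (auto simp: half_homs_def)
    qed
    ultimately show ?thesis
      by (simp add: homs_const_def homs_iff[OF H])
  qed
  have "(\<Sum>\<kappa>\<in>K. card (?\<gamma> \<kappa>) ^ 2) = card (SIGMA \<kappa>:K. ?\<gamma> \<kappa> \<times> ?\<gamma> \<kappa>)"
    using K fin by (simp add: power2_eq_square card_cartesian_product)
  also have "\<dots> \<le> card (homs_const H G (W \<union> \<phi> ` W))"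
  proof (rule card_inj_on_le)
    show "(\<lambda>(\<kappa>, p, q). glue p q) ` (SIGMA \<kappa>:K. ?\<gamma> \<kappa> \<times> ?\<gamma> \<kappa>) \<subseteq> homs_const H G (W \<union> \<phi> ` W)"
      using glue_hom by auto
    show "finite (homs_const H G (W \<union> \<phi> ` W))"
      using finite_homs_const[OF H G] .
    show "inj_on (\<lambda>(\<kappa>, p, q). glue p q) (SIGMA \<kappa>:K. ?\<gamma> \<kappa> \<times> ?\<gamma> \<kappa>)"
    proof (rule inj_onI)
      fix s t
      assume st: "s \<in> (SIGMA \<kappa>:K. ?\<gamma> \<kappa> \<times> ?\<gamma> \<kappa>)" "t \<in> (SIGMA \<kappa>:K. ?\<gamma> \<kappa> \<times> ?\<gamma> \<kappa>)"
        and eq0: "(\<lambda>(\<kappa>, p, q). glue p q) s = (\<lambda>(\<kappa>, p, q). glue p q) t"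
      obtain g y p q where s: "s = ((g, y), p, q)" by (metis prod.exhaust)
      obtain g' y' p' q' where t: "t = ((g', y'), p', q')" by (metis prod.exhaust)
      have pq: "p \<in> ?\<gamma> (g, y)" "q \<in> ?\<gamma> (g, y)"
        and pq': "p' \<in> ?\<gamma> (g', y')" "q' \<in> ?\<gamma> (g', y')"
        and eq: "glue p q = glue p' q'"
        using st eq0 s t by auto
      have PE: "r \<in> ?D \<rightarrow>\<^sub>E verts G" if "r \<in> {p, q, p', q'}" for r
        using that pq pq' by (auto simp: half_homs_def)
      have p: "p = p'"
      proof (rule PiE_ext[OF PE PE])
        fix v assume "v \<in> ?D"
        then show "p v = p' v" using glue_D[of v p q] glue_D[of v p' q'] eq by simp
      qed auto
      have q: "q = q'"
      proof (rule PiE_ext[OF PE PE])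
        fix v assume v: "v \<in> ?D"
        show "q v = q' v" using glue_phi[OF v pq] glue_phi[OF v pq'] eq by simp
      qed auto
      \<comment> \<open>An element of \<open>W\<close> exposes the common value, so equal halves
        come from the same \<kappa>; this is where nonemptiness of \<open>W\<close> enters.\<close>
      obtain w where w: "w \<in> W" using W by blast
      have "y = y'" "g = g'"
        using pq(1) pq'(1) p w by (auto simp: half_homs_def)
      then show "s = t"
        using p q s t by simp
    qed
  qed
  finally show ?thesis .
qed

text \<open>A homomorphism constant on \<open>R\<close> splits into its half on \<open>A\<close> and
  the fixed set, and its half on \<open>B\<close> and the fixed set folded over by \<phi>, both with
  the same \<kappa>. Hence the count is at most the sum of |\<alpha>||\<beta>|. After
  Cauchy--Schwarz, gluing bounds the sum of |\<alpha>|^2 by the homomorphisms constant on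
  \<psi>(\<open>R\<close>), and the sum of |\<beta>|^2 by all homomorphisms. Admissibility makes
  both traces of \<open>R\<close> nonempty.\<close>

lemma reflection_step:
  assumes H: "simple_graph H" and G: "simple_graph G" and nice: "nice H A B \<phi>"
    and adm: "admissible H X\<^sub>1 X\<^sub>2 A B \<phi> R" and R: "R \<subseteq> verts H"
  shows "card (homs_const H G R) ^ 2 \<le> card (homs_const H G (psi H A B \<phi> R)) * card (homs H G)"
proof -
  let ?F = "fixed_verts H \<phi>"
  let ?D = "A \<union> ?F"
  note n = niceD[OF nice]
  define U where "U = R \<inter> ?D"
  define W where "W = \<phi> ` (R \<inter> (B \<union> ?F))"
  define K where "K = (?F \<rightarrow>\<^sub>E verts G) \<times> verts G"
  define \<alpha> where "\<alpha> = half_homs H G ?D ?F U"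
  define \<beta> where "\<beta> = half_homs H G ?D ?F W"
  have finF: "finite ?F" "finite ?D"
    using n(3,14) finite_verts[OF H] by (auto intro: finite_subset)
  have K: "finite K"
    unfolding K_def using finF finite_verts[OF G] by (auto simp: finite_PiE)
  have U: "U \<noteq> {}" "U \<subseteq> ?D" and W: "W \<noteq> {}" "W \<subseteq> ?D"
    using adm n(6,13) by (auto simp: U_def W_def admissible_def)
  have "finite (half_homs H G ?D ?F Z \<kappa>)" for Z \<kappa>
    unfolding half_homs_def
    by (rule finite_subset[of _ "?D \<rightarrow>\<^sub>E verts G"]) (use finF finite_verts[OF G] in \<open>auto simp: finite_PiE\<close>)
  then have fin: "finite (\<alpha> \<kappa>)" "finite (\<beta> \<kappa>)" for \<kappa>
    by (auto simp: \<alpha>_def \<beta>_def)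
  obtain r where r: "r \<in> U" using U by blast
  have "card (homs_const H G R) \<le> card (SIGMA \<kappa>:K. \<alpha> \<kappa> \<times> \<beta> \<kappa>)"
  proof (rule card_inj_on_le)
    let ?h = "\<lambda>f. ((restrict f ?F, f r), restrict f ?D, restrict (f \<circ> \<phi>) ?D)"
    show "finite (SIGMA \<kappa>:K. \<alpha> \<kappa> \<times> \<beta> \<kappa>)"
      using K fin by auto
    show "?h ` homs_const H G R \<subseteq> (SIGMA \<kappa>:K. \<alpha> \<kappa> \<times> \<beta> \<kappa>)"
    proof (rule image_subsetI)
      fix f assume "f \<in> homs_const H G R"
      then have fV: "\<And>v. v \<in> verts H \<Longrightarrow> f v \<in> verts G"
        and fe: "\<And>u v. {u, v} \<in> edges H \<Longrightarrow> {f u, f v} \<in> edges G"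
        and fR: "\<And>u v. u \<in> R \<Longrightarrow> v \<in> R \<Longrightarrow> f u = f v"
        unfolding homs_const_def homs_iff[OF H] by blast+
      have D: "v \<in> verts H" if "v \<in> ?D" for v
        using that n(3,14) by blast
      have rR: "r \<in> R" "r \<in> verts H" using r R by (auto simp: U_def)
      have "(restrict f ?F, f r) \<in> K"
        using fV n(14) rR by (auto simp: K_def)
      moreover have "restrict f ?D \<in> \<alpha> (restrict f ?F, f r)"
      proof -
        have "restrict (restrict f ?D) ?F = restrict f ?F"
          by (auto simp: fun_eq_iff restrict_def)
        moreover have "restrict f ?D u = f r" if "u \<in> U" for u
          using that fR[of u r] rR by (auto simp: U_def)
        ultimately show ?thesis
          using fV fe D by (auto simp: \<alpha>_def half_homs_def)
      qed
      moreover have "restrict (f \<circ> \<phi>) ?D \<in> \<beta> (restrict f ?F, f r)"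
      proof -
        have "{f (\<phi> u), f (\<phi> v)} \<in> edges G" if "u \<in> ?D" "v \<in> ?D" "{u, v} \<in> edges H" for u v
          using fe n(8) D that by blast
        moreover have "restrict (restrict (f \<circ> \<phi>) ?D) ?F = restrict f ?F"
          using n(13) by (auto simp: fun_eq_iff restrict_def)
        moreover have "restrict (f \<circ> \<phi>) ?D w = f r" if w: "w \<in> W" for w
        proof -
          obtain s where s: "s \<in> R" "w = \<phi> s" using w by (auto simp: W_def)
          then have "f (\<phi> w) = f r"
            using fR[of s r] rR n(2)[of s] R by auto
          then show ?thesis using w W by auto
        qed
        moreover have "restrict (f \<circ> \<phi>) ?D \<in> ?D \<rightarrow>\<^sub>E verts G"
          using fV D n(1) by auto
        ultimately show ?thesis
          by (simp add: \<beta>_def half_homs_def)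
      qed
      ultimately show "?h f \<in> (SIGMA \<kappa>:K. \<alpha> \<kappa> \<times> \<beta> \<kappa>)"
        by simp
    qed
    show "inj_on ?h (homs_const H G R)"
    proof (rule inj_onI)
      fix f f' assume f: "f \<in> homs_const H G R" "f' \<in> homs_const H G R" and eq: "?h f = ?h f'"
      show "f = f'"
      proof (rule PiE_ext)
        show "f \<in> verts H \<rightarrow>\<^sub>E verts G" "f' \<in> verts H \<rightarrow>\<^sub>E verts G"
          using f by (auto simp: homs_const_def homs_def)
        fix v assume v: "v \<in> verts H"
        have eD: "f u = f' u" "f (\<phi> u) = f' (\<phi> u)" if u: "u \<in> ?D" for u
        proof -
          have "restrict f ?D u = restrict f' ?D u" "restrict (f \<circ> \<phi>) ?D u = restrict (f' \<circ> \<phi>) ?D u"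
            using eq by simp_all
          then show "f u = f' u" "f (\<phi> u) = f' (\<phi> u)" using u by simp_all
        qed
        show "f v = f' v"
        proof (cases "v \<in> ?D")
          case True
          then show ?thesis using eD by blast
        next
          case False
          then have "\<phi> v \<in> ?D" using n(6) n(7)[OF v] by blast
          then show ?thesis using eD(2)[of "\<phi> v"] n(2)[OF v] by simp
        qed
      qed
    qed
  qed
  also have "\<dots> = (\<Sum>\<kappa>\<in>K. card (\<alpha> \<kappa>) * card (\<beta> \<kappa>))"
    using K fin by (simp add: card_cartesian_product)
  finally have "real (card (homs_const H G R)) \<le> real (\<Sum>\<kappa>\<in>K. card (\<alpha> \<kappa>) * card (\<beta> \<kappa>))"
    by (rule of_nat_mono)
  then have "real (card (homs_const H G R)) ^ 2
                  \<le> (\<Sum>\<kappa>\<in>K. real (card (\<alpha> \<kappa>)) * real (card (\<beta> \<kappa>))) ^ 2"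
    by (intro power_mono) simp_all
  also have "\<dots> \<le> (\<Sum>\<kappa>\<in>K. real (card (\<alpha> \<kappa>)) ^ 2) * (\<Sum>\<kappa>\<in>K. real (card (\<beta> \<kappa>)) ^ 2)"
    by (rule Cauchy_Schwarz_ineq_sum)
  also have "\<dots> = real ((\<Sum>\<kappa>\<in>K. card (\<alpha> \<kappa>) ^ 2) * (\<Sum>\<kappa>\<in>K. card (\<beta> \<kappa>) ^ 2))"
    by simp
  also have "\<dots> \<le> real (card (homs_const H G (psi H A B \<phi> R)) * card (homs H G))"
  proof (intro of_nat_mono mult_mono)
    have "(\<Sum>\<kappa>\<in>K. card (\<alpha> \<kappa>) ^ 2) \<le> card (homs_const H G (U \<union> \<phi> ` U))"
      unfolding \<alpha>_def by (rule sum_half_homs_square_le[OF H G nice U K])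
    also have "\<dots> \<le> card (homs_const H G (psi H A B \<phi> R))"
      by (intro card_mono finite_homs_const H G homs_const_antimono) (auto simp: psi_def U_def)
    finally show "(\<Sum>\<kappa>\<in>K. card (\<alpha> \<kappa>) ^ 2) \<le> card (homs_const H G (psi H A B \<phi> R))" .
    have "(\<Sum>\<kappa>\<in>K. card (\<beta> \<kappa>) ^ 2) \<le> card (homs_const H G (W \<union> \<phi> ` W))"
      unfolding \<beta>_def by (rule sum_half_homs_square_le[OF H G nice W K])
    also have "\<dots> \<le> card (homs H G)"
      by (intro card_mono finite_homs H G homs_const_subset)
    finally show "(\<Sum>\<kappa>\<in>K. card (\<beta> \<kappa>) ^ 2) \<le> card (homs H G)" .
  qed auto
  finally show ?thesis
    by (simp only: of_nat_power[symmetric] of_nat_le_iff)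
qed

text \<open>For M = \<open>card (homs H G)\<close> > 0, dividing by M^(2^m) turns the claim into x_m
  \<ge> x_0^(2^m) for the proportions x_j of homomorphisms constant on \<open>S j\<close>; this
  iterates \<open>reflection_step\<close> in the form x_(j+1) \<ge> x_j^2. The form without division
  also makes sense for M = 0.\<close>

lemma reflection_iterate:
  assumes H: "simple_graph H" and G: "simple_graph G" and R: "S 0 \<subseteq> verts H"
    and step: "\<forall>j<m. nice H (A j) (B j) (\<phi> j) \<and> admissible H X\<^sub>1 X\<^sub>2 (A j) (B j) (\<phi> j) (S j) \<and>
               S (Suc j) = psi H (A j) (B j) (\<phi> j) (S j)"
  shows "card (homs_const H G (S 0)) ^ 2 ^ m
           \<le> card (homs_const H G (S m)) * card (homs H G) ^ (2 ^ m - 1)"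
proof -
  \<comment> \<open>The inclusion joins the induction because the next reflection requires
    \<open>S m\<close> to consist of vertices.\<close>
  have "S m \<subseteq> verts H \<and> card (homs_const H G (S 0)) ^ 2 ^ m
           \<le> card (homs_const H G (S m)) * card (homs H G) ^ (2 ^ m - 1)"
    using step
  proof (induction m)
    case 0
    then show ?case using R by simp
  next
    case (Suc m)
    let ?M = "card (homs H G)"
    have IH: "S m \<subseteq> verts H"
      "card (homs_const H G (S 0)) ^ 2 ^ m \<le> card (homs_const H G (S m)) * ?M ^ (2 ^ m - 1)"
      using Suc by auto
    have s: "nice H (A m) (B m) (\<phi> m)" "admissible H X\<^sub>1 X\<^sub>2 (A m) (B m) (\<phi> m) (S m)"
      "S (Suc m) = psi H (A m) (B m) (\<phi> m) (S m)"
      using Suc.prems by auto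
    have "S (Suc m) \<subseteq> verts H"
      using s(3) IH(1) niceD(1)[OF s(1)] by (auto simp: psi_def)
    have "card (homs_const H G (S 0)) ^ 2 ^ Suc m = (card (homs_const H G (S 0)) ^ 2 ^ m) ^ 2"
      by (simp add: power_mult[symmetric] mult.commute)
    also have "\<dots> \<le> (card (homs_const H G (S m)) * ?M ^ (2 ^ m - 1)) ^ 2"
      using IH(2) by (rule power_mono) simp
    also have "\<dots> = card (homs_const H G (S m)) ^ 2 * ?M ^ (2 * (2 ^ m - 1))"
      by (simp add: power_mult_distrib power_mult[symmetric] mult.commute)
    also have "\<dots> \<le> (card (homs_const H G (S (Suc m))) * ?M) * ?M ^ (2 * (2 ^ m - 1))"
      using reflection_step[OF H G s(1,2) IH(1)] s(3) by (intro mult_right_mono) auto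
    also have "\<dots> = card (homs_const H G (S (Suc m))) * ?M ^ Suc (2 * (2 ^ m - 1))"
      by simp
    also have "Suc (2 * (2 ^ m - 1)) = (2 ^ Suc m - 1 :: nat)"
      using one_le_power[of "2::nat" m] unfolding power_Suc by arith
    finally show ?case using \<open>S (Suc m) \<subseteq> verts H\<close> by simp
  qed
  then show ?thesis by blast
qed

text \<open>By pigeonhole, one of the finitely many pairs \<open>R\<close> is identified by at least
  a 1/|\<open>Ps\<close>| proportion of the homomorphisms, and reflections carry this over to a
  whole part. What matters is the order of quantifiers: the number of reflections depends on
  \<open>R\<close> alone, so one \<open>Q\<close> serves every host.\<close>

lemma reflective_homs_bound:
  assumes H: "simple_graph H" and bip: "bipartition H X\<^sub>1 X\<^sub>2" and refl: "reflective H X\<^sub>1 X\<^sub>2"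
  shows "\<exists>Q::nat. \<forall>G :: 'b graph. simple_graph G \<longrightarrow>
           (\<forall>f\<in>homs H G. \<not> inj_on f X\<^sub>1 \<or> \<not> inj_on f X\<^sub>2) \<longrightarrow>
           card (homs H G) \<le> Q * (card (homs_const H G X\<^sub>1) + card (homs_const H G X\<^sub>2))"
proof -
  define Ps where "Ps = {R. (R \<subseteq> X\<^sub>1 \<or> R \<subseteq> X\<^sub>2) \<and> card R = 2}"
  let ?T = "\<lambda>G :: 'b graph. card (homs_const H G X\<^sub>1) + card (homs_const H G X\<^sub>2)"
  have X: "X\<^sub>1 \<subseteq> verts H" "X\<^sub>2 \<subseteq> verts H"
    using bip by (auto simp: bipartition_def)
  have finPs: "finite Ps"
    using X by (intro finite_subset[OF _ finite_Pow_iff[THEN iffD2, OF finite_verts[OF H]]])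
      (auto simp: Ps_def)
  have "\<forall>R\<in>Ps. \<exists>m::nat. \<forall>G :: 'b graph. simple_graph G \<longrightarrow>
          card (homs_const H G R) ^ 2 ^ m \<le> ?T G * card (homs H G) ^ (2 ^ m - 1)"
  proof
    fix R assume "R \<in> Ps"
    then obtain X where X': "X \<in> {X\<^sub>1, X\<^sub>2}" "R \<subseteq> X" "card R = 2"
      by (auto simp: Ps_def)
    then have "\<exists>(m :: nat) A B \<phi> S. S 0 = R \<and> S m = X \<and>
        (\<forall>j<m. nice H (A j) (B j) (\<phi> j) \<and>
               admissible H X\<^sub>1 X\<^sub>2 (A j) (B j) (\<phi> j) (S j) \<and>
               S (Suc j) = psi H (A j) (B j) (\<phi> j) (S j))"
      using refl unfolding reflective_def by blast
    then obtain m :: nat and A B \<phi> S where S: "S 0 = R" "S m = X"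
      and step: "\<forall>j<m. nice H (A j) (B j) (\<phi> j) \<and>
               admissible H X\<^sub>1 X\<^sub>2 (A j) (B j) (\<phi> j) (S j) \<and>
               S (Suc j) = psi H (A j) (B j) (\<phi> j) (S j)"
      by (elim exE conjE) blast
    have "card (homs_const H G R) ^ 2 ^ m \<le> ?T G * card (homs H G) ^ (2 ^ m - 1)"
      if G: "simple_graph G" for G :: "'b graph"
    proof -
      have "S 0 \<subseteq> verts H" using S X' X by auto
      from reflection_iterate[OF H G this step]
      have "card (homs_const H G R) ^ 2 ^ m \<le> card (homs_const H G X) * card (homs H G) ^ (2 ^ m - 1)"
        using S by simp
      also have "\<dots> \<le> ?T G * card (homs H G) ^ (2 ^ m - 1)"
        using X' by (intro mult_right_mono) auto
      finally show ?thesis .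
    qed
    then show "\<exists>m::nat. \<forall>G :: 'b graph. simple_graph G \<longrightarrow>
          card (homs_const H G R) ^ 2 ^ m \<le> ?T G * card (homs H G) ^ (2 ^ m - 1)"
      by blast
  qed
  then obtain m :: "'a set \<Rightarrow> nat" where
    m: "\<And>R G. R \<in> Ps \<Longrightarrow> simple_graph (G :: 'b graph) \<Longrightarrow>
          card (homs_const H G R) ^ 2 ^ m R \<le> ?T G * card (homs H G) ^ (2 ^ m R - 1)"
    by (metis bchoice)
  \<comment> \<open>After cancelling, the pair \<open>R\<close> contributes the factor
    |\<open>Ps\<close>|^(2^(m R)); the sum dominates them all, whichever pair the pigeonhole
    returns.\<close>
  define Q where "Q = (\<Sum>R\<in>Ps. card Ps ^ 2 ^ m R)"
  have "card (homs H G) \<le> Q * ?T G"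
    if G: "simple_graph G" and ninj: "\<forall>f\<in>homs H G. \<not> inj_on f X\<^sub>1 \<or> \<not> inj_on f X\<^sub>2"
    for G :: "'b graph"
  proof (cases "card (homs H G) = 0")
    case False
    let ?M = "card (homs H G)" and ?c = "\<lambda>R. card (homs_const H G R)"
    have "homs H G \<subseteq> (\<Union>R\<in>Ps. homs_const H G R)"
    proof
      fix f assume f: "f \<in> homs H G"
      with ninj obtain u v where "(u \<in> X\<^sub>1 \<and> v \<in> X\<^sub>1) \<or> (u \<in> X\<^sub>2 \<and> v \<in> X\<^sub>2)" "u \<noteq> v" "f u = f v"
        unfolding inj_on_def by blast
      then have "{u, v} \<in> Ps" "f \<in> homs_const H G {u, v}"
        using f by (auto simp: Ps_def homs_const_def)
      then show "f \<in> (\<Union>R\<in>Ps. homs_const H G R)" by blast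
    qed
    then have "?M \<le> card (\<Union>R\<in>Ps. homs_const H G R)"
      using finPs finite_homs_const[OF H G] by (intro card_mono) auto
    also have "\<dots> \<le> (\<Sum>R\<in>Ps. ?c R)"
      using finPs by (rule card_UN_le)
    finally have M_le: "?M \<le> (\<Sum>R\<in>Ps. ?c R)" .
    have "\<exists>R\<in>Ps. ?M \<le> card Ps * ?c R"
    proof (rule ccontr)
      assume "\<not> ?thesis"
      then have lt: "card Ps * ?c R < ?M" if "R \<in> Ps" for R using that by force
      have "Ps \<noteq> {}" using M_le False by auto
      then have "(\<Sum>R\<in>Ps. card Ps * ?c R) < (\<Sum>R\<in>Ps. ?M)"
        using lt finPs by (intro sum_strict_mono) auto
      then have "card Ps * (\<Sum>R\<in>Ps. ?c R) < card Ps * ?M"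
        by (simp add: sum_distrib_left)
      then show False using M_le by simp
    qed
    then obtain R where R: "R \<in> Ps" "?M \<le> card Ps * ?c R" by blast
    have "Suc (2 ^ m R - 1) = 2 ^ m R"
      by simp
    then have "?M * ?M ^ (2 ^ m R - 1) = ?M ^ 2 ^ m R"
      by (metis power_Suc)
    also have "\<dots> \<le> (card Ps * ?c R) ^ 2 ^ m R"
      using R(2) by (rule power_mono) simp
    also have "\<dots> \<le> card Ps ^ 2 ^ m R * (?T G * ?M ^ (2 ^ m R - 1))"
      unfolding power_mult_distrib using m[OF R(1) G] by (rule mult_left_mono) simp
    finally have "?M * ?M ^ (2 ^ m R - 1) \<le> (card Ps ^ 2 ^ m R * ?T G) * ?M ^ (2 ^ m R - 1)"
      by (simp only: mult.assoc)
    then have "?M \<le> card Ps ^ 2 ^ m R * ?T G"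
      using False by (simp only: mult_le_cancel2) auto
    also have "\<dots> \<le> Q * ?T G"
      unfolding Q_def using finPs R(1) by (intro mult_right_mono member_le_sum) auto
    finally show ?thesis .
  qed simp
  then show ?thesis by blast
qed

section \<open>Bipartite graphs\<close>

lemma bipartition_commute:
  assumes "bipartition G X Y"
  shows "bipartition G Y X"
proof -
  have "\<exists>y\<in>Y. \<exists>x\<in>X. e = {y, x}" if e: "e \<in> edges G" for e
  proof -
    obtain x y where "x \<in> X" "y \<in> Y" "e = {x, y}"
      using assms e unfolding bipartition_def by metis
    then show ?thesis by (auto simp: insert_commute)
  qed
  then show ?thesis
    using assms by (auto simp: bipartition_def)
qed

lemma bipartition_edgeD:
  assumes "bipartition G X Y" "{u, v} \<in> edges G"
  shows "u \<in> X \<longleftrightarrow> v \<notin> X" "u \<in> X \<longleftrightarrow> v \<in> Y" "u \<in> verts G" "v \<in> verts G"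
proof -
  obtain x y where "x \<in> X" "y \<in> Y" "{u, v} = {x, y}"
    using assms unfolding bipartition_def by metis
  then have "(u \<in> X \<and> v \<in> Y) \<or> (u \<in> Y \<and> v \<in> X)"
    by (auto simp: doubleton_eq_iff)
  then show "u \<in> X \<longleftrightarrow> v \<notin> X" "u \<in> X \<longleftrightarrow> v \<in> Y" "u \<in> verts G" "v \<in> verts G"
    using assms(1) by (auto simp: bipartition_def)
qed

text \<open>Along an edge both memberships, of u in \<open>X\<^sub>1\<close> and of f u in
  \<open>Y\<^sub>1\<close>, flip, so whether they agree is constant on the connected graph
  \<open>H\<close>.\<close>

lemma homs_bipartite_cases:
  assumes H: "simple_graph H" "connected_graph H" and X: "bipartition H X\<^sub>1 X\<^sub>2"
    and Y: "bipartition G Y\<^sub>1 Y\<^sub>2" and f: "f \<in> homs H G"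
  obtains "f ` X\<^sub>1 \<subseteq> Y\<^sub>1" "f ` X\<^sub>2 \<subseteq> Y\<^sub>2" | "f ` X\<^sub>1 \<subseteq> Y\<^sub>2" "f ` X\<^sub>2 \<subseteq> Y\<^sub>1"
proof -
  have edge: "{f u, f v} \<in> edges G" if "{u, v} \<in> edges H" for u v
    using f that by (simp add: homs_iff[OF H(1)])
  have step: "(f u \<in> Y\<^sub>1 \<longleftrightarrow> u \<in> X\<^sub>1) \<longleftrightarrow> (f v \<in> Y\<^sub>1 \<longleftrightarrow> v \<in> X\<^sub>1)"
    if "(u, v) \<in> {(x, y). {x, y} \<in> edges H}\<^sup>*" for u v
    using that
  proof induction
    case (step y z)
    then have e: "{y, z} \<in> edges H" by simp
    show ?case
      using step.IH bipartition_edgeD(1)[OF X e] bipartition_edgeD(1)[OF Y edge[OF e]] by blast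
  qed simp
  obtain r where r: "r \<in> verts H"
    using H(2) by (auto simp: connected_graph_def)
  have *: "(f v \<in> Y\<^sub>1 \<longleftrightarrow> v \<in> X\<^sub>1) \<longleftrightarrow> (f r \<in> Y\<^sub>1 \<longleftrightarrow> r \<in> X\<^sub>1)" if "v \<in> verts H" for v
    using step[of r v] H(2) r that unfolding connected_graph_def by blast
  have fV: "f v \<in> Y\<^sub>1 \<union> Y\<^sub>2" if "v \<in> verts H" for v
    using f Y that by (auto simp: homs_def bipartition_def)
  have XV: "X\<^sub>1 \<union> X\<^sub>2 = verts H" "X\<^sub>1 \<inter> X\<^sub>2 = {}"
    using X by (auto simp: bipartition_def)
  show thesis
  proof (cases "f r \<in> Y\<^sub>1 \<longleftrightarrow> r \<in> X\<^sub>1")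
    case True
    then show ?thesis
      using * fV XV by (intro that(1)) blast+
  next
    case False
    then show ?thesis
      using * fV XV by (intro that(2)) blast+
  qed
qed

section \<open>Counting edges and stars by degrees\<close>

abbreviation nbrs :: "'a graph \<Rightarrow> 'a \<Rightarrow> 'a set" where
  "nbrs G v \<equiv> {u. {u, v} \<in> edges G}"

lemma finite_nbrs: "simple_graph G \<Longrightarrow> finite (nbrs G v)"
  by (rule finite_subset[OF _ finite_verts]) (auto dest: simple_graph_edgeD)

lemma card_edges_bipartite:
  assumes G: "simple_graph G" and Y: "bipartition G Y\<^sub>1 Y\<^sub>2"
  shows "card (edges G) = (\<Sum>y\<in>Y\<^sub>1. card (nbrs G y))"
proof -
  have fin: "finite Y\<^sub>1"
    using Y finite_verts[OF G] by (auto simp: bipartition_def intro: finite_subset)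
  have "bij_betw (\<lambda>(y, u). {u, y}) (SIGMA y:Y\<^sub>1. nbrs G y) (edges G)"
  proof (rule bij_betwI')
    fix s t assume s: "s \<in> (SIGMA y:Y\<^sub>1. nbrs G y)" and t: "t \<in> (SIGMA y:Y\<^sub>1. nbrs G y)"
    then have "snd s \<notin> Y\<^sub>1" "snd t \<notin> Y\<^sub>1" "fst s \<in> Y\<^sub>1" "fst t \<in> Y\<^sub>1"
      using bipartition_edgeD(1)[OF Y] by auto
    then show "((\<lambda>(y, u). {u, y}) s = (\<lambda>(y, u). {u, y}) t) \<longleftrightarrow> s = t"
      by (cases s; cases t) (auto simp: doubleton_eq_iff)
  next
    fix e assume "e \<in> edges G"
    then obtain x y where "x \<in> Y\<^sub>1" "e = {x, y}"
      using Y unfolding bipartition_def by metis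
    then show "\<exists>s\<in>(SIGMA y:Y\<^sub>1. nbrs G y). e = (\<lambda>(y, u). {u, y}) s"
      using \<open>e \<in> edges G\<close> by (intro bexI[of _ "(x, y)"]) (auto simp: insert_commute)
  qed auto
  then have "card (edges G) = card (SIGMA y:Y\<^sub>1. nbrs G y)"
    by (simp add: bij_betw_same_card)
  also have "\<dots> = (\<Sum>y\<in>Y\<^sub>1. card (nbrs G y))"
    using fin finite_nbrs[OF G] by simp
  finally show ?thesis .
qed

text \<open>Once the common value y on \<open>X\<close> is known, each remaining vertex has a
  neighbour in \<open>X\<close> and must go to a neighbour of y: the homomorphism is a star centred
  at y, determined by its leaves.\<close>

lemma card_homs_const_le:
  assumes H: "simple_graph H" and G: "simple_graph G" and X: "X \<noteq> {}" "X \<subseteq> verts H"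
    and nb: "\<And>v. v \<in> verts H - X \<Longrightarrow> \<exists>x\<in>X. {x, v} \<in> edges H"
  shows "card (homs_const H G X) \<le> (\<Sum>y\<in>verts G. card (nbrs G y) ^ card (verts H - X))"
proof -
  let ?U = "verts H - X"
  obtain r where r: "r \<in> X" using X by blast
  have finU: "finite ?U" using finite_verts[OF H] by simp
  have "card (homs_const H G X) \<le> card (SIGMA y:verts G. ?U \<rightarrow>\<^sub>E nbrs G y)"
  proof (rule card_inj_on_le)
    let ?h = "\<lambda>f. (f r, restrict f ?U)"
    show "finite (SIGMA y:verts G. ?U \<rightarrow>\<^sub>E nbrs G y)"
      using finU finite_verts[OF G] finite_nbrs[OF G] by (auto intro!: finite_PiE)
    show "?h ` homs_const H G X \<subseteq> (SIGMA y:verts G. ?U \<rightarrow>\<^sub>E nbrs G y)"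
    proof (rule image_subsetI)
      fix f assume f: "f \<in> homs_const H G X"
      have "f v \<in> nbrs G (f r)" if v: "v \<in> ?U" for v
      proof -
        obtain x where x: "x \<in> X" "{x, v} \<in> edges H" using nb[OF v] by blast
        then have "{f x, f v} \<in> edges G" "f x = f r"
          using f r unfolding homs_const_def homs_iff[OF H] by blast+
        then show ?thesis by (simp add: insert_commute)
      qed
      moreover have "f r \<in> verts G"
        using r X subsetD[OF homs_const_subset f] by (auto simp: homs_def)
      ultimately show "?h f \<in> (SIGMA y:verts G. ?U \<rightarrow>\<^sub>E nbrs G y)"
        by auto
    qed
    show "inj_on ?h (homs_const H G X)"
    proof (rule inj_onI)
      fix f f' assume f: "f \<in> homs_const H G X" "f' \<in> homs_const H G X" and eq: "?h f = ?h f'"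
      show "f = f'"
      proof (rule PiE_ext)
        show "f \<in> verts H \<rightarrow>\<^sub>E verts G" "f' \<in> verts H \<rightarrow>\<^sub>E verts G"
          using f[THEN subsetD[OF homs_const_subset]] by (auto simp: homs_def)
        fix v assume v: "v \<in> verts H"
        show "f v = f' v"
        proof (cases "v \<in> X")
          case True
          then have "f v = f r" "f' v = f' r"
            using f r unfolding homs_const_def by blast+
          then show ?thesis using eq by simp
        next
          case False
          then have "restrict f ?U v = restrict f' ?U v" using eq by simp
          then show ?thesis using False v by simp
        qed
      qed
    qed
  qed
  also have "\<dots> = (\<Sum>y\<in>verts G. card (nbrs G y) ^ card ?U)"
    using finU finite_verts[OF G] finite_nbrs[OF G] by (simp add: card_PiE finite_PiE)
  finally show ?thesis .
qed

text \<open>When the opposite part has exactly d vertices, d-regularity makes a vertex adjacent to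
  all of it; the isomorphism then only numbers the two parts.\<close>

lemma isomorphic_complete_bipartite:
  assumes H: "simple_graph H" and bip: "bipartition H X\<^sub>1 X\<^sub>2" and reg: "regular_graph H d"
    and c: "card X\<^sub>1 = d" "card X\<^sub>2 = d"
  shows "isomorphic H (complete_bipartite d d)"
proof -
  have X: "X\<^sub>1 \<union> X\<^sub>2 = verts H" "X\<^sub>1 \<inter> X\<^sub>2 = {}"
    using bip by (auto simp: bipartition_def)
  then have fin: "finite X\<^sub>1" "finite X\<^sub>2"
    using finite_verts[OF H] by (metis finite_Un)+
  have adj: "{u, v} \<in> edges H" if "u \<in> X\<^sub>1" "v \<in> X\<^sub>2" for u v
  proof -
    have "nbrs H u = X\<^sub>2"
    proof (rule card_subset_eq[OF fin(2)])
      show "nbrs H u \<subseteq> X\<^sub>2"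
        using bipartition_edgeD(2)[OF bipartition_commute[OF bip]] that X by blast
      show "card (nbrs H u) = card X\<^sub>2"
        using reg that c X by (auto simp: regular_graph_def)
    qed
    then have "v \<in> nbrs H u" using that by simp
    then show ?thesis by (simp add: insert_commute)
  qed
  obtain h\<^sub>1 where h1: "bij_betw h\<^sub>1 X\<^sub>1 {..<d}"
    using ex_bij_betw_finite_nat[OF fin(1)] c by (auto simp: lessThan_atLeast0)
  obtain h\<^sub>2 where h2: "bij_betw h\<^sub>2 X\<^sub>2 {..<d}"
    using ex_bij_betw_finite_nat[OF fin(2)] c by (auto simp: lessThan_atLeast0)
  define f where "f v = (if v \<in> X\<^sub>1 then Inl (h\<^sub>1 v) else Inr (h\<^sub>2 v))" for v
  have f1: "f v = Inl (h\<^sub>1 v)" "h\<^sub>1 v < d" if "v \<in> X\<^sub>1" for v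
    using that bij_betwE[OF h1] by (auto simp: f_def)
  have f2: "f v = Inr (h\<^sub>2 v)" "h\<^sub>2 v < d" if "v \<in> X\<^sub>2" for v
    using that bij_betwE[OF h2] X by (auto simp: f_def)
  have "bij_betw f (X\<^sub>1 \<union> X\<^sub>2) (Inl ` {..<d} \<union> Inr ` {..<d})"
  proof (rule bij_betw_combine)
    show "bij_betw f X\<^sub>1 (Inl ` {..<d})"
      using bij_betw_trans[OF h1, of Inl "Inl ` {..<d}"] f1
      by (auto simp: bij_betw_def inj_on_def image_comp cong: image_cong)
    show "bij_betw f X\<^sub>2 (Inr ` {..<d})"
      using bij_betw_trans[OF h2, of Inr "Inr ` {..<d}"] f2
      by (auto simp: bij_betw_def inj_on_def image_comp cong: image_cong)
  qed auto
  then have "bij_betw f (verts H) (verts (complete_bipartite d d))"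
    using X by (simp add: complete_bipartite_def Plus_def)
  moreover have "{u, v} \<in> edges H \<longleftrightarrow> {f u, f v} \<in> edges (complete_bipartite d d)"
    if uv: "u \<in> verts H" "v \<in> verts H" for u v
  proof -
    have R: "{f u, f v} \<in> edges (complete_bipartite d d) \<longleftrightarrow> (u \<in> X\<^sub>1 \<longleftrightarrow> v \<in> X\<^sub>2)"
    proof -
      consider "u \<in> X\<^sub>1" "v \<in> X\<^sub>1" | "u \<in> X\<^sub>1" "v \<in> X\<^sub>2" | "u \<in> X\<^sub>2" "v \<in> X\<^sub>1" | "u \<in> X\<^sub>2" "v \<in> X\<^sub>2"
        using uv X by blast
      then show ?thesis
        by cases (use X f1 f2 in \<open>auto simp: complete_bipartite_def doubleton_eq_iff\<close>)
    qed
    have "{u, v} \<in> edges H \<longleftrightarrow> (u \<in> X\<^sub>1 \<longleftrightarrow> v \<in> X\<^sub>2)"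
      using adj[of u v] adj[of v u] bipartition_edgeD(2)[OF bip, of u v] uv X
      by (auto simp: insert_commute)
    with R show ?thesis by simp
  qed
  ultimately show ?thesis
    by (auto simp: isomorphic_def is_graph_iso_def)
qed

section \<open>Blow-ups\<close>

text \<open>Vertex y becomes \<open>w y\<close> copies, and each edge a complete bipartite graph
  between copies. The pairs (y, i) are coded as natural numbers because \<open>sidorenko\<close>
  quantifies over graphs on \<open>nat\<close>.\<close>

definition blow_up :: "nat graph \<Rightarrow> (nat \<Rightarrow> nat) \<Rightarrow> nat graph" where
  "blow_up G w = \<lparr>verts = prod_encode ` (SIGMA y:verts G. {..<w y}),
     edges = {{prod_encode (x, i), prod_encode (y, j)} | x i y j.
                {x, y} \<in> edges G \<and> i < w x \<and> j < w y}\<rparr>"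

lemma blow_up_edge_iff:
  "{prod_encode (x, i), prod_encode (y, j)} \<in> edges (blow_up G w) \<longleftrightarrow>
     {x, y} \<in> edges G \<and> i < w x \<and> j < w y"
  by (auto simp: blow_up_def doubleton_eq_iff insert_commute)

lemma simple_blow_up:
  assumes G: "simple_graph G"
  shows "simple_graph (blow_up G w)"
  using finite_verts[OF G] simple_graph_edgeD[OF G]
  by (fastforce simp: simple_graph_def blow_up_def card_2_iff intro: finite_SigmaI)

lemma card_verts_blow_up:
  assumes "simple_graph G"
  shows "card (verts (blow_up G w)) = (\<Sum>y\<in>verts G. w y)"
  using finite_verts[OF assms] by (simp add: blow_up_def card_image inj_prod_encode)

lemma bipartition_blow_up:
  assumes "bipartition G Y\<^sub>1 Y\<^sub>2"
  shows "bipartition (blow_up G w) (prod_encode ` (SIGMA y:Y\<^sub>1. {..<w y}))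
           (prod_encode ` (SIGMA y:Y\<^sub>2. {..<w y}))"
proof -
  have *: "\<exists>s\<in>prod_encode ` (SIGMA y:Y\<^sub>1. {..<w y}). \<exists>t\<in>prod_encode ` (SIGMA y:Y\<^sub>2. {..<w y}). e = {s, t}"
    if e: "e \<in> edges (blow_up G w)" for e
  proof -
    obtain x i y j where xy: "e = {prod_encode (x, i), prod_encode (y, j)}"
      "{x, y} \<in> edges G" "i < w x" "j < w y"
      using e by (auto simp: blow_up_def)
    from xy(2) have "(x \<in> Y\<^sub>1 \<and> y \<in> Y\<^sub>2) \<or> (x \<in> Y\<^sub>2 \<and> y \<in> Y\<^sub>1)"
      using bipartition_edgeD[OF assms xy(2)] assms unfolding bipartition_def by blast
    then show ?thesis
    proof
      assume "x \<in> Y\<^sub>1 \<and> y \<in> Y\<^sub>2"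
      then show ?thesis using xy by (intro bexI[of _ "prod_encode (x, i)"] bexI[of _ "prod_encode (y, j)"]) auto
    next
      assume "x \<in> Y\<^sub>2 \<and> y \<in> Y\<^sub>1"
      then show ?thesis using xy
        by (intro bexI[of _ "prod_encode (y, j)"] bexI[of _ "prod_encode (x, i)"]) (auto simp: insert_commute)
    qed
  qed
  have "Y\<^sub>1 \<union> Y\<^sub>2 = verts G" "Y\<^sub>1 \<inter> Y\<^sub>2 = {}"
    using assms by (auto simp: bipartition_def)
  then show ?thesis
    using * by (auto simp: bipartition_def blow_up_def[of G w])
qed

lemma card_edges_blow_up:
  assumes G: "simple_graph G" and Y: "bipartition G Y\<^sub>1 Y\<^sub>2"
    and w: "\<And>y. y \<in> Y\<^sub>1 \<Longrightarrow> w y = b" "\<And>y. y \<in> Y\<^sub>2 \<Longrightarrow> w y = a"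
  shows "card (edges (blow_up G w)) = a * b * card (edges G)"
proof -
  let ?B = "blow_up G w"
  have nb: "card (nbrs ?B (prod_encode (y, i))) = a * card (nbrs G y)" if y: "y \<in> Y\<^sub>1" "i < b" for y i
  proof -
    have "nbrs ?B (prod_encode (y, i)) = prod_encode ` (nbrs G y \<times> {..<a})"
    proof (intro set_eqI iffI)
      fix s assume s: "s \<in> nbrs ?B (prod_encode (y, i))"
      obtain x j where x: "s = prod_encode (x, j)" by (metis prod_decode_inverse surj_pair)
      then have xj: "{x, y} \<in> edges G" "j < w x"
        using s by (auto simp: blow_up_edge_iff)
      then have "x \<in> Y\<^sub>2"
        using bipartition_edgeD(2)[OF Y, of y x] y by (simp add: insert_commute)
      then show "s \<in> prod_encode ` (nbrs G y \<times> {..<a})"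
        using x xj w(2) by auto
    next
      fix s assume "s \<in> prod_encode ` (nbrs G y \<times> {..<a})"
      then obtain x j where x: "s = prod_encode (x, j)" "{x, y} \<in> edges G" "j < a" by auto
      then have "x \<in> Y\<^sub>2"
        using bipartition_edgeD(2)[OF Y, of y x] y by (simp add: insert_commute)
      then show "s \<in> nbrs ?B (prod_encode (y, i))"
        using x w y by (simp add: blow_up_edge_iff)
    qed
    then show ?thesis
      by (simp add: card_image inj_prod_encode card_cartesian_product)
  qed
  have fin: "finite Y\<^sub>1"
    using Y finite_verts[OF G] by (auto simp: bipartition_def intro: finite_subset)
  have "card (edges ?B) = (\<Sum>s\<in>prod_encode ` (SIGMA y:Y\<^sub>1. {..<w y}). card (nbrs ?B s))"
    by (rule card_edges_bipartite[OF simple_blow_up[OF G] bipartition_blow_up[OF Y]])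
  also have "\<dots> = (\<Sum>s\<in>(SIGMA y:Y\<^sub>1. {..<w y}). card (nbrs ?B (prod_encode s)))"
    by (simp add: sum.reindex inj_prod_encode)
  also have "\<dots> = (\<Sum>y\<in>Y\<^sub>1. \<Sum>i<w y. card (nbrs ?B (prod_encode (y, i))))"
    using fin by (subst sum.Sigma) (auto intro!: sum.cong)
  also have "\<dots> = (\<Sum>y\<in>Y\<^sub>1. b * (a * card (nbrs G y)))"
    using nb w(1) by (intro sum.cong) auto
  also have "\<dots> = a * b * card (edges G)"
    by (simp add: card_edges_bipartite[OF G Y] sum_distrib_left mult_ac)
  finally show ?thesis .
qed

text \<open>A homomorphism into the blow-up is determined by its projection to \<open>G\<close> and
  the index of the copy used at each vertex, with \<open>w (f v)\<close> possible indices at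
  v.\<close>

lemma card_homs_blow_up_le:
  assumes H: "simple_graph H" and G: "simple_graph G"
  shows "card (homs H (blow_up G w)) \<le> (\<Sum>f\<in>homs H G. \<Prod>v\<in>verts H. w (f v))"
proof -
  let ?V = "verts H" and ?S = "SIGMA f:homs H G. PiE (verts H) (\<lambda>v. {..<w (f v)})"
  let ?h = "\<lambda>g. (restrict (fst \<circ> prod_decode \<circ> g) ?V, restrict (snd \<circ> prod_decode \<circ> g) ?V)"
  have "card (homs H (blow_up G w)) \<le> card ?S"
  proof (rule card_inj_on_le)
    show "finite ?S"
      using finite_homs[OF H G] finite_verts[OF H] by (auto intro!: finite_PiE)
    show "?h ` homs H (blow_up G w) \<subseteq> ?S"
    proof (rule image_subsetI)
      fix g assume g: "g \<in> homs H (blow_up G w)"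
      have gV: "g v \<in> prod_encode ` (SIGMA y:verts G. {..<w y})" if "v \<in> ?V" for v
        using g that by (auto simp: homs_def blow_up_def)
      have "{fst (prod_decode (g u)), fst (prod_decode (g v))} \<in> edges G" if "{u, v} \<in> edges H" for u v
      proof -
        have "{g u, g v} \<in> edges (blow_up G w)"
          using g that by (simp add: homs_iff[OF H])
        then show ?thesis
          using blow_up_edge_iff[of "fst (prod_decode (g u))" "snd (prod_decode (g u))"
              "fst (prod_decode (g v))" "snd (prod_decode (g v))" G w]
          by simp
      qed
      then have "restrict (fst \<circ> prod_decode \<circ> g) ?V \<in> homs H G"
        using gV simple_graph_edgeD[OF H] by (fastforce simp: homs_iff[OF H])
      moreover have "restrict (snd \<circ> prod_decode \<circ> g) ?V \<in> PiE ?V (\<lambda>v. {..<w (fst (prod_decode (g v)))})"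
        using gV by fastforce
      ultimately show "?h g \<in> ?S"
        by (auto simp: PiE_iff)
    qed
    show "inj_on ?h (homs H (blow_up G w))"
    proof (rule inj_onI)
      fix g g' assume g: "g \<in> homs H (blow_up G w)" "g' \<in> homs H (blow_up G w)" and eq: "?h g = ?h g'"
      show "g = g'"
      proof (rule PiE_ext)
        show "g \<in> ?V \<rightarrow>\<^sub>E verts (blow_up G w)" "g' \<in> ?V \<rightarrow>\<^sub>E verts (blow_up G w)"
          using g by (auto simp: homs_def)
        fix v assume v: "v \<in> ?V"
        have "restrict (fst \<circ> prod_decode \<circ> g) ?V v = restrict (fst \<circ> prod_decode \<circ> g') ?V v"
          "restrict (snd \<circ> prod_decode \<circ> g) ?V v = restrict (snd \<circ> prod_decode \<circ> g') ?V v"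
          using eq by simp_all
        then have "prod_decode (g v) = prod_decode (g' v)"
          using v by (simp add: prod_eq_iff)
        then show "g v = g' v"
          by (metis prod_decode_inverse)
      qed
    qed
  qed
  also have "\<dots> = (\<Sum>f\<in>homs H G. \<Prod>v\<in>verts H. w (f v))"
    using finite_homs[OF H G] finite_verts[OF H] by (simp add: card_PiE finite_PiE)
  finally show ?thesis .
qed

text \<open>Blowing up each side by the size of the other makes the host balanced, and every homomorphism
  of \<open>H\<close> gains the same factor because the two parts of \<open>H\<close> have equal size.\<close>

lemma sidorenko_bipartite:
  fixes G :: "nat graph"
  assumes H: "simple_graph H" "connected_graph H" and X: "bipartition H X\<^sub>1 X\<^sub>2"
    and k: "card X\<^sub>1 = k" "card X\<^sub>2 = k" and sid: "sidorenko H"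
    and G: "simple_graph G" and Y: "bipartition G Y\<^sub>1 Y\<^sub>2"
    and a: "card Y\<^sub>1 = a" "a > 0" and b: "card Y\<^sub>2 = b" "b > 0"
  shows "(2 * real a * real b) ^ (2 * k) * (real (card (edges G)) / (2 * real a * real b)) ^ card (edges H)
           \<le> real (card (homs H G)) * (real a * real b) ^ k"
proof -
  define w where "w y = (if y \<in> Y\<^sub>1 then b else a)" for y
  let ?B = "blow_up G w"
  have Y': "Y\<^sub>1 \<union> Y\<^sub>2 = verts G" "Y\<^sub>1 \<inter> Y\<^sub>2 = {}" and X': "X\<^sub>1 \<union> X\<^sub>2 = verts H" "X\<^sub>1 \<inter> X\<^sub>2 = {}"
    using X Y by (auto simp: bipartition_def)
  have fin: "finite Y\<^sub>1" "finite Y\<^sub>2" "finite X\<^sub>1" "finite X\<^sub>2"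
    using Y' X' finite_verts[OF G] finite_verts[OF H(1)] by (metis finite_Un)+
  have w1: "w y = b" if "y \<in> Y\<^sub>1" for y using that by (simp add: w_def)
  have w2: "w y = a" if "y \<in> Y\<^sub>2" for y using that Y' by (auto simp: w_def)
  have "card (verts ?B) = (\<Sum>y\<in>Y\<^sub>1. w y) + (\<Sum>y\<in>Y\<^sub>2. w y)"
    using fin Y' by (simp add: card_verts_blow_up[OF G] sum.union_disjoint flip: Y'(1))
  also have "\<dots> = 2 * a * b"
    using w1 w2 a b by simp
  finally have vB: "real (card (verts ?B)) = 2 * real a * real b"
    by simp
  have eB: "card (edges ?B) = a * b * card (edges G)"
    using card_edges_blow_up[OF G Y] w1 w2 by blast
  have kV: "card (verts H) = 2 * k"
    using fin X' k by (simp add: card_Un_disjoint flip: X'(1))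
  \<comment> \<open>With e = \<open>card (edges G)\<close>, the blow-up has 2ab vertices and abe
    edges, so its density is 2abe / (2ab)^2 = e / (2ab).\<close>
  have "edge_density ?B (real (card (edges G)) / (2 * real a * real b))"
    using a b unfolding edge_density_def vB eB by (simp add: field_simps power2_eq_square)
  then have "(2 * real a * real b) ^ (2 * k) * (real (card (edges G)) / (2 * real a * real b)) ^ card (edges H)
      \<le> real (card (homs H ?B))"
    using sid simple_blow_up[OF G] unfolding sidorenko_def vB[symmetric] kV[symmetric] by blast
  also have "\<dots> \<le> real (\<Sum>f\<in>homs H G. \<Prod>v\<in>verts H. w (f v))"
    using card_homs_blow_up_le[OF H(1) G] by (rule of_nat_mono)
  also have "(\<Sum>f\<in>homs H G. \<Prod>v\<in>verts H. w (f v)) = (\<Sum>f\<in>homs H G. (a * b) ^ k)"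
  proof (rule sum.cong)
    fix f assume f: "f \<in> homs H G"
    have "(\<Prod>v\<in>verts H. w (f v)) = (\<Prod>v\<in>X\<^sub>1. w (f v)) * (\<Prod>v\<in>X\<^sub>2. w (f v))"
      using fin X' by (simp add: prod.union_disjoint flip: X'(1))
    also have "\<dots> = (a * b) ^ k"
    proof (rule homs_bipartite_cases[OF H X Y f])
      assume "f ` X\<^sub>1 \<subseteq> Y\<^sub>1" "f ` X\<^sub>2 \<subseteq> Y\<^sub>2"
      then have "(\<Prod>v\<in>X\<^sub>1. w (f v)) = (\<Prod>v\<in>X\<^sub>1. b)" "(\<Prod>v\<in>X\<^sub>2. w (f v)) = (\<Prod>v\<in>X\<^sub>2. a)"
        by (auto intro!: prod.cong w1 w2 simp del: prod_constant)
      then show ?thesis using k by (simp add: power_mult_distrib)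
    next
      assume "f ` X\<^sub>1 \<subseteq> Y\<^sub>2" "f ` X\<^sub>2 \<subseteq> Y\<^sub>1"
      then have "(\<Prod>v\<in>X\<^sub>1. w (f v)) = (\<Prod>v\<in>X\<^sub>1. a)" "(\<Prod>v\<in>X\<^sub>2. w (f v)) = (\<Prod>v\<in>X\<^sub>2. b)"
        by (auto intro!: prod.cong w1 w2 simp del: prod_constant)
      then show ?thesis using k by (simp add: power_mult_distrib)
    qed
    finally show "(\<Prod>v\<in>verts H. w (f v)) = (a * b) ^ k" .
  qed simp
  finally show ?thesis by simp
qed

section \<open>Almost regular bipartite subgraphs\<close>

text \<open>Vertices are added one at a time, each on the side opposite to the majority of its
  earlier neighbours, so that at least half of its edges to them are cut.\<close>

lemma exists_large_cut:
  assumes "finite V" "\<And>e. e \<in> E \<Longrightarrow> e \<subseteq> V \<and> card e = 2"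
  shows "\<exists>Y\<subseteq>V. card E \<le> 2 * card {e \<in> E. \<exists>x\<in>Y. \<exists>y\<in>V - Y. e = {x, y}}"
  using assms
proof (induction V arbitrary: E rule: finite_induct)
  case empty
  then have "E = {}" by fastforce
  then show ?case by simp
next
  case (insert v V)
  define E' where "E' = {e \<in> E. v \<notin> e}"
  define N where "N = {u \<in> V. {u, v} \<in> E}"
  have finE: "finite E"
    using insert.prems insert.hyps(1) by (intro finite_subset[of E "Pow (insert v V)"]) auto
  have fin: "finite E'" "finite N"
    using finE insert.hyps(1) by (auto simp: E'_def N_def)
  have E: "E = E' \<union> (\<lambda>u. {u, v}) ` N"
  proof (intro equalityI subsetI)
    fix e assume e: "e \<in> E"
    then obtain x y where xy: "e = {x, y}" "x \<noteq> y" "x \<in> insert v V" "y \<in> insert v V"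
      using insert.prems[OF e] by (auto simp: card_2_iff)
    then show "e \<in> E' \<union> (\<lambda>u. {u, v}) ` N"
      using e by (auto simp: E'_def N_def insert_commute)
  qed (auto simp: E'_def N_def)
  have inj: "inj_on (\<lambda>u. {u, v}) S" if "S \<subseteq> V" for S
    using that insert.hyps(2) by (auto simp: inj_on_def doubleton_eq_iff)
  have "card E \<le> card E' + card ((\<lambda>u. {u, v}) ` N)"
    unfolding E by (rule card_Un_le)
  also have "\<dots> \<le> card E' + card N"
    using fin by (simp add: card_image_le)
  finally have cE: "card E \<le> card E' + card N" .
  have "e \<subseteq> V \<and> card e = 2" if "e \<in> E'" for e
    using that insert.prems by (auto simp: E'_def)
  from insert.IH[OF this] obtain Y
    where Y: "Y \<subseteq> V" "card E' \<le> 2 * card {e \<in> E'. \<exists>x\<in>Y. \<exists>y\<in>V - Y. e = {x, y}}"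
    by blast
  let ?K = "{e \<in> E'. \<exists>x\<in>Y. \<exists>y\<in>V - Y. e = {x, y}}"
  let ?C = "\<lambda>Y. {e \<in> E. \<exists>x\<in>Y. \<exists>y\<in>insert v V - Y. e = {x, y}}"
  \<comment> \<open>The old cut edges avoid v, so they are disjoint from the newly cut edges at v
    and the counts add up.\<close>
  have grow: "card ?K + card S \<le> card (?C Z)"
    if "S \<subseteq> N" "?K \<subseteq> ?C Z" "(\<lambda>u. {u, v}) ` S \<subseteq> ?C Z" for S Z
  proof -
    have SV: "S \<subseteq> V" using that(1) by (auto simp: N_def)
    then have "card ?K + card S = card ?K + card ((\<lambda>u. {u, v}) ` S)"
      using inj by (simp add: card_image)
    also have "\<dots> = card (?K \<union> (\<lambda>u. {u, v}) ` S)"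
      using fin finite_subset[OF that(1) fin(2)] by (subst card_Un_disjoint) (auto simp: E'_def finE)
    also have "\<dots> \<le> card (?C Z)"
      using that finE by (intro card_mono) auto
    finally show ?thesis .
  qed
  have N: "card N = card (N \<inter> Y) + card (N - Y)"
    using fin(2) by (metis card_Int_Diff)
  have v: "v \<notin> Y" "v \<notin> V" using Y insert.hyps by auto
  show ?case
  proof (cases "card (N - Y) \<le> card (N \<inter> Y)")
    case True
    have "card ?K + card (N \<inter> Y) \<le> card (?C Y)"
      using v by (intro grow) (fastforce simp: E'_def N_def)+
    then show ?thesis
      using Y cE N True by (intro exI[of _ Y]) auto
  next
    case False
    have "card ?K + card (N - Y) \<le> card (?C (insert v Y))"
    proof (intro grow)
      show "(\<lambda>u. {u, v}) ` (N - Y) \<subseteq> ?C (insert v Y)"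
        using v by (auto simp: N_def insert_commute)
      show "?K \<subseteq> ?C (insert v Y)"
        using v by (fastforce simp: E'_def)
    qed auto
    then show ?thesis
      using Y cE N False by (intro exI[of _ "insert v Y"]) auto
  qed
qed

text \<open>The nonzero values of \<open>f\<close> fall into N dyadic classes [2^j, 2^(j+1)), so one
  class carries at least 1/N of the total. Within a class any value is less than twice any other,
  hence at most twice the average.\<close>

lemma dyadic_pigeonhole:
  fixes f :: "'a \<Rightarrow> nat"
  assumes "finite A" and f: "\<And>v. v \<in> A \<Longrightarrow> f v < 2 ^ N"
  shows "\<exists>S\<subseteq>A. sum f A \<le> N * sum f S \<and> (\<forall>v\<in>S. card S * f v \<le> 2 * sum f S)"
proof -
  define S where "S j = {v \<in> A. 2 ^ j \<le> f v \<and> f v < 2 ^ (j + 1)}" for j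
  have fin: "finite (S j)" for j using assms(1) by (simp add: S_def)
  have cover: "\<exists>j<N. v \<in> S j" if v: "v \<in> A" "f v \<noteq> 0" for v
  proof -
    obtain j where j: "2 ^ j \<le> f v" "f v < 2 ^ (j + 1)"
      using ex_power_ivl1[of 2 "f v"] v(2) by auto
    then have "(2::nat) ^ j < 2 ^ N"
      using f[OF v(1)] by linarith
    then show ?thesis
      using j v by (intro exI[of _ j]) (auto simp: S_def)
  qed
  have "sum f A \<le> (\<Sum>v\<in>A. \<Sum>j<N. if v \<in> S j then f v else 0)"
  proof (rule sum_mono)
    fix v assume v: "v \<in> A"
    show "f v \<le> (\<Sum>j<N. if v \<in> S j then f v else 0)"
    proof (cases "f v = 0")
      case False
      then obtain j where j: "j < N" "v \<in> S j" using cover v by blast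
      then have "f v = (if v \<in> S j then f v else 0)" by simp
      also have "\<dots> \<le> (\<Sum>j<N. if v \<in> S j then f v else 0)"
        using j by (intro member_le_sum) auto
      finally show ?thesis .
    qed simp
  qed
  also have "\<dots> = (\<Sum>j<N. \<Sum>v\<in>A. if v \<in> S j then f v else 0)"
    by (rule sum.swap)
  also have "\<dots> = (\<Sum>j<N. sum f (S j))"
  proof (rule sum.cong)
    fix j
    have "A \<inter> S j = S j" by (auto simp: S_def)
    then show "(\<Sum>v\<in>A. if v \<in> S j then f v else 0) = sum f (S j)"
      using sum.inter_restrict[OF assms(1), of f "S j"] by simp
  qed simp
  finally have le: "sum f A \<le> (\<Sum>j<N. sum f (S j))" .
  have "\<exists>j. sum f A \<le> N * sum f (S j)"
  proof (rule ccontr)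
    assume "\<not> ?thesis"
    then have lt: "N * sum f (S j) < sum f A" for j by (simp add: not_le)
    then have "N > 0" using le by (cases N) auto
    then have "(\<Sum>j<N. N * sum f (S j)) < (\<Sum>j<N. sum f A)"
      using lt by (intro sum_strict_mono) auto
    then show False
      using le by (simp add: sum_distrib_left[symmetric])
  qed
  then obtain j where j: "sum f A \<le> N * sum f (S j)" by blast
  have "card (S j) * f v \<le> 2 * sum f (S j)" if "v \<in> S j" for v
  proof -
    have "card (S j) * f v = (\<Sum>u\<in>S j. f v)" by simp
    also have "\<dots> \<le> (\<Sum>u\<in>S j. 2 * f u)"
    proof (rule sum_mono)
      fix u assume "u \<in> S j"
      then have "2 ^ j \<le> f u" "f v < 2 * 2 ^ j"
        using that by (auto simp: S_def)
      then show "f v \<le> 2 * f u" by linarith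
    qed
    finally show ?thesis by (simp add: sum_distrib_left)
  qed
  then show ?thesis
    using j by (intro exI[of _ "S j"]) (auto simp: S_def)
qed

section \<open>Bipartite subgraphs between two vertex classes\<close>

definition bip_subgraph :: "'a graph \<Rightarrow> 'a set \<Rightarrow> 'a set \<Rightarrow> 'a graph" where
  "bip_subgraph G S T = \<lparr>verts = S \<union> T, edges = {e \<in> edges G. \<exists>x\<in>S. \<exists>y\<in>T. e = {x, y}}\<rparr>"

lemma bip_subgraph:
  assumes "simple_graph G" "S \<subseteq> verts G" "T \<subseteq> verts G" "S \<inter> T = {}"
  shows "simple_graph (bip_subgraph G S T)" "bipartition (bip_subgraph G S T) S T"
    "verts (bip_subgraph G S T) \<subseteq> verts G" "edges (bip_subgraph G S T) \<subseteq> edges G"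
    "v \<in> S \<Longrightarrow> nbrs (bip_subgraph G S T) v = nbrs G v \<inter> T"
    "v \<in> T \<Longrightarrow> nbrs (bip_subgraph G S T) v = nbrs G v \<inter> S"
proof -
  let ?B = "bip_subgraph G S T"
  show "simple_graph ?B"
    using assms by (auto simp: simple_graph_def bip_subgraph_def intro: finite_subset)
  show "bipartition ?B S T" "verts ?B \<subseteq> verts G" "edges ?B \<subseteq> edges G"
    using assms by (auto simp: bipartition_def bip_subgraph_def)
  show "nbrs ?B v = nbrs G v \<inter> T" if v: "v \<in> S"
  proof (rule set_eqI)
    fix u
    show "u \<in> nbrs ?B v \<longleftrightarrow> u \<in> nbrs G v \<inter> T"
      using v assms(4) by (auto simp: bip_subgraph_def doubleton_eq_iff)
  qed
  show "nbrs ?B v = nbrs G v \<inter> S" if v: "v \<in> T"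
  proof (rule set_eqI)
    fix u
    show "u \<in> nbrs ?B v \<longleftrightarrow> u \<in> nbrs G v \<inter> S"
      using v assms(4) by (auto simp: bip_subgraph_def doubleton_eq_iff)
  qed
qed

text \<open>A logarithmic loss in the number of edges buys near-regularity on both sides, and such a loss
  is harmless because the theorem allows an arbitrary small power of \<open>n\<close>.\<close>

lemma exists_almost_regular_subgraph:
  assumes G: "simple_graph G" and Y: "bipartition G Y\<^sub>1 Y\<^sub>2" and N: "card (verts G) < 2 ^ N"
  obtains S T where "S \<subseteq> Y\<^sub>1" "T \<subseteq> Y\<^sub>2"
    "card (edges G) \<le> N ^ 2 * card (edges (bip_subgraph G S T))"
    "\<And>v. v \<in> S \<Longrightarrow> card S * card (nbrs (bip_subgraph G S T) v) \<le> 2 * N * card (edges (bip_subgraph G S T))"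
    "\<And>v. v \<in> T \<Longrightarrow> card T * card (nbrs (bip_subgraph G S T) v) \<le> 2 * N * card (edges (bip_subgraph G S T))"
proof -
  have Y': "Y\<^sub>1 \<union> Y\<^sub>2 = verts G" "Y\<^sub>1 \<inter> Y\<^sub>2 = {}"
    using Y by (auto simp: bipartition_def)
  have fin: "finite Y\<^sub>1" "finite Y\<^sub>2"
    using Y' finite_verts[OF G] by (metis finite_Un)+
  have small: "card (nbrs G v \<inter> Z) < 2 ^ N" for v Z
  proof -
    have "card (nbrs G v \<inter> Z) \<le> card (verts G)"
      using finite_verts[OF G] simple_graph_edgeD[OF G] by (intro card_mono) auto
    then show ?thesis using N by simp
  qed
  let ?f = "\<lambda>v. card (nbrs G v)"
  have "?f v < 2 ^ N" for v using small[of v UNIV] by simp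
  from dyadic_pigeonhole[OF fin(1), of ?f, OF this] obtain S where
    S: "S \<subseteq> Y\<^sub>1" "sum ?f Y\<^sub>1 \<le> N * sum ?f S" "\<And>v. v \<in> S \<Longrightarrow> card S * ?f v \<le> 2 * sum ?f S"
    by blast
  \<comment> \<open>\<open>T\<close> is selected by the degrees into \<open>S\<close>, not into
    \<open>Y\<^sub>1\<close>, so that the degrees on \<open>T\<close> are already those of the final
    subgraph.\<close>
  let ?g = "\<lambda>v. card (nbrs G v \<inter> S)"
  from dyadic_pigeonhole[OF fin(2), of ?g, OF small] obtain T where
    T: "T \<subseteq> Y\<^sub>2" "sum ?g Y\<^sub>2 \<le> N * sum ?g T" "\<And>v. v \<in> T \<Longrightarrow> card T * ?g v \<le> 2 * sum ?g T"
    by blast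
  let ?B = "bip_subgraph G S T"
  have ST: "S \<subseteq> verts G" "T \<subseteq> verts G" "S \<inter> T = {}" "Y\<^sub>2 \<subseteq> verts G" "S \<inter> Y\<^sub>2 = {}"
    using S T Y' by auto
  note B = bip_subgraph[OF G ST(1,2,3)] and C = bip_subgraph[OF G ST(1,4,5)]
  have eG: "card (edges G) = sum ?f Y\<^sub>1"
    by (rule card_edges_bipartite[OF G Y])
  have "?f v = card (nbrs (bip_subgraph G S Y\<^sub>2) v)" if v: "v \<in> S" for v
  proof -
    have "nbrs G v \<subseteq> Y\<^sub>2"
    proof
      fix u assume "u \<in> nbrs G v"
      then have "{v, u} \<in> edges G" by (simp add: insert_commute)
      then show "u \<in> Y\<^sub>2"
        using bipartition_edgeD(2)[OF Y] v S(1) by blast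
    qed
    then show ?thesis using C(5)[OF v] by (simp add: Int_absorb2)
  qed
  then have "sum ?f S = card (edges (bip_subgraph G S Y\<^sub>2))"
    by (simp add: card_edges_bipartite[OF C(1,2)])
  also have "\<dots> = sum ?g Y\<^sub>2"
    using C(6) by (simp add: card_edges_bipartite[OF C(1) bipartition_commute[OF C(2)]])
  finally have fg: "sum ?f S = sum ?g Y\<^sub>2" .
  have eB: "card (edges ?B) = sum ?g T"
    using B(6) by (simp add: card_edges_bipartite[OF B(1) bipartition_commute[OF B(2)]])
  show thesis
  proof (rule that[OF S(1) T(1)])
    have "card (edges G) \<le> N * sum ?f S" using S(2) eG by simp
    also have "\<dots> \<le> N * (N * sum ?g T)" using T(2) fg by (intro mult_left_mono) auto
    finally show "card (edges G) \<le> N ^ 2 * card (edges ?B)"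
      by (simp add: eB power2_eq_square)
    \<comment> \<open>Passing to \<open>T\<close> can only lower degrees on \<open>S\<close>, but
      the number of edges, and with it the average degree, may fall by a factor N; hence 2N instead
      of 2.\<close>
    show "card S * card (nbrs ?B v) \<le> 2 * N * card (edges ?B)" if v: "v \<in> S" for v
    proof -
      have "card (nbrs ?B v) \<le> ?f v"
        using B(5)[OF v] finite_nbrs[OF G] by (simp add: card_mono)
      then have "card S * card (nbrs ?B v) \<le> card S * ?f v" by (rule mult_left_mono) simp
      also have "\<dots> \<le> 2 * sum ?g Y\<^sub>2" using S(3)[OF v] fg by simp
      also have "\<dots> \<le> 2 * (N * sum ?g T)" using T(2) by simp
      finally show ?thesis by (simp add: eB)
    qed
    show "card T * card (nbrs ?B v) \<le> 2 * N * card (edges ?B)" if v: "v \<in> T" for v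
    \<comment> \<open>On this side the pigeonhole gives the factor 2; enlarging it to 2N takes N
      \<ge> 1, and N = 0 means that the host has no vertices.\<close>
    proof (cases "N = 0")
      case True
      then have "card (verts G) = 0" using N by simp
      then have "verts G = {}" using finite_verts[OF G] by simp
      then show ?thesis using v ST by auto
    next
      case False
      have "card T * card (nbrs ?B v) \<le> 2 * sum ?g T" using T(3)[OF v] B(6)[OF v] by simp
      also have "\<dots> \<le> 2 * N * sum ?g T" using False by simp
      finally show ?thesis by (simp add: eB)
    qed
  qed
qed

text \<open>\<open>Max\<close> is an attained value only on a finite nonempty set. Finiteness comes
  from the crude bound 2^n on the number of edges, and the edgeless host is a member because
  \<open>H\<close> has an edge.\<close>

lemma turan_ex_le:
  assumes H: "edges H \<noteq> {}"
    and B: "\<And>G :: nat graph. simple_graph G \<Longrightarrow> card (verts G) = n \<Longrightarrow>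
              \<not> (\<exists>F. subgraph F G \<and> isomorphic F H) \<Longrightarrow> real (card (edges G)) \<le> B"
    and simple: "simple_graph H"
  shows "real (turan_ex n H) \<le> B"
proof -
  let ?S = "{card (edges G) | G :: nat graph.
     simple_graph G \<and> card (verts G) = n \<and> \<not> (\<exists>F. subgraph F G \<and> isomorphic F H)}"
  have "card (edges G) \<le> 2 ^ n" if "simple_graph G" "card (verts G) = n" for G :: "nat graph"
  proof -
    have "card (edges G) \<le> card (Pow (verts G))"
      using that by (intro card_mono) (auto simp: simple_graph_def)
    then show ?thesis using that finite_verts[OF that(1)] by (simp add: card_Pow)
  qed
  then have fin: "finite ?S"
    by (intro finite_subset[of ?S "{..2 ^ n}"]) auto
  let ?E = "\<lparr>verts = {..<n}, edges = {}\<rparr> :: nat graph"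
  have "\<not> (subgraph F ?E \<and> isomorphic F H)" for F
  proof
    assume F: "subgraph F ?E \<and> isomorphic F H"
    then obtain f where f: "is_graph_iso F H f" and "edges F = {}"
      by (auto simp: isomorphic_def subgraph_def)
    obtain e where "e \<in> edges H" using H by blast
    then obtain x y where "x \<in> verts H" "y \<in> verts H" "{x, y} \<in> edges H"
      using simple by (metis simple_graph_edgeE)
    moreover have "f ` verts F = verts H"
      using f by (auto simp: is_graph_iso_def bij_betw_def)
    ultimately obtain u v where "u \<in> verts F" "v \<in> verts F" "{f u, f v} \<in> edges H"
      by (metis imageE)
    then show False
      using f \<open>edges F = {}\<close> by (auto simp: is_graph_iso_def)
  qed
  then have "card (edges ?E) \<in> ?S"
    by (intro CollectI exI[of _ ?E]) (auto simp: simple_graph_def)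
  then have "?S \<noteq> {}" by blast
  from Max_in[OF fin this] have "turan_ex n H \<in> ?S"
    by (simp only: turan_ex_def)
  then show ?thesis using B by auto
qed

section \<open>The edge bound\<close>

text \<open>Here a and b are the side sizes, e the number of edges, L the allowed ratio of maximum
  to average degree, M the number of homomorphisms, and k + q the number of edges of
  \<open>H\<close>. Comparing the two bounds on M gives e^q a^(k-1) \<le> Q 2^(k+q+1) L^k (ab)^q,
  and then a, b \<le> n is used.\<close>

lemma density_inequality_ordered:
  fixes a b e L M Q n :: real
  assumes pos: "0 < a" "a \<le> b" "b \<le> n" "0 < e" "0 \<le> L" "0 \<le> Q" and k: "1 \<le> k" "k - 1 \<le> q"
    and lower: "(2 * a * b) ^ (2 * k) * (e / (2 * a * b)) ^ (k + q) \<le> M * (a * b) ^ k"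
    and upper: "M \<le> Q * (a * (L * e / a) ^ k + b * (L * e / b) ^ k)"
  shows "e ^ q \<le> Q * 2 ^ (k + q + 1) * L ^ k * n ^ (2 * q - (k - 1))"
proof -
  define p where "p = a * b"
  have b: "0 < b" and p: "0 < p" using pos by (auto simp: p_def)
  have power_div: "x * (L * e / x) ^ k = (L * e) ^ k / x ^ (k - 1)" if "x > 0" for x
    using that k(1) by (cases k) (auto simp: field_simps)
  \<comment> \<open>A side of size x contributes (Le)^k / x^(k-1) stars, so the smaller side
    dominates.\<close>
  have "b * (L * e / b) ^ k \<le> (L * e) ^ k / a ^ (k - 1)"
    unfolding power_div[OF b] using pos by (intro divide_left_mono power_mono mult_pos_pos zero_less_power) auto
  then have "a * (L * e / a) ^ k + b * (L * e / b) ^ k \<le> 2 * ((L * e) ^ k / a ^ (k - 1))"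
    using power_div[OF pos(1)] by simp
  then have "M \<le> Q * (2 * ((L * e) ^ k / a ^ (k - 1)))"
    using upper mult_left_mono[OF _ pos(6)] order_trans by blast
  then have "M * p ^ k \<le> Q * (2 * ((L * e) ^ k / a ^ (k - 1))) * p ^ k"
    using p by (intro mult_right_mono) auto
  then have "(2 * p) ^ (2 * k) * (e / (2 * p)) ^ (k + q) \<le> Q * (2 * ((L * e) ^ k / a ^ (k - 1))) * p ^ k"
    using lower by (simp add: p_def mult.assoc)
  \<comment> \<open>Multiplying by \<open>a ^ (k - 1) * (2 * p) ^ (k + q)\<close> clears all
    denominators and exposes the common factor \<open>e ^ k * p ^ (2 * k)\<close>.\<close>
  then have "(2 * p) ^ (2 * k) * (e / (2 * p)) ^ (k + q) * (a ^ (k - 1) * (2 * p) ^ (k + q))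
      \<le> Q * (2 * ((L * e) ^ k / a ^ (k - 1))) * p ^ k * (a ^ (k - 1) * (2 * p) ^ (k + q))"
    using p pos by (intro mult_right_mono) auto
  also have "(2 * p) ^ (2 * k) * (e / (2 * p)) ^ (k + q) * (a ^ (k - 1) * (2 * p) ^ (k + q))
      = 2 ^ (2 * k) * (e ^ q * a ^ (k - 1)) * (e ^ k * p ^ (2 * k))"
    using p by (simp add: power_divide power_add power_mult_distrib)
  also have "Q * (2 * ((L * e) ^ k / a ^ (k - 1))) * p ^ k * (a ^ (k - 1) * (2 * p) ^ (k + q))
      = Q * 2 * (L * e) ^ k * p ^ k * (2 * p) ^ (k + q)"
    using pos by simp
  also have "\<dots> = Q * 2 ^ (k + q + 1) * L ^ k * p ^ q * (e ^ k * p ^ (2 * k))"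
  proof -
    have "p ^ (2 * k) = p ^ k * p ^ k" by (simp add: mult_2 power_add)
    then show ?thesis by (simp add: power_add power_mult_distrib)
  qed
  finally have "2 ^ (2 * k) * (e ^ q * a ^ (k - 1)) \<le> Q * 2 ^ (k + q + 1) * L ^ k * p ^ q"
    using p pos by (elim mult_right_le_imp_le) simp
  moreover have "1 * (e ^ q * a ^ (k - 1)) \<le> 2 ^ (2 * k) * (e ^ q * a ^ (k - 1))"
    using pos by (intro mult_right_mono one_le_power) auto
  ultimately have *: "e ^ q * a ^ (k - 1) \<le> Q * 2 ^ (k + q + 1) * L ^ k * p ^ q"
    by linarith
  \<comment> \<open>Since k - 1 \<le> q, a factor a^(k-1) can be split off to cancel the one on the
    left; the remaining 2q - (k - 1) factors are at most n.\<close>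
  have "p ^ q = a ^ (q - (k - 1)) * b ^ q * a ^ (k - 1)"
  proof -
    have "a ^ q = a ^ (q - (k - 1)) * a ^ (k - 1)" using k(2) by (simp flip: power_add)
    then show ?thesis by (simp add: p_def power_mult_distrib)
  qed
  also have "\<dots> \<le> n ^ (q - (k - 1)) * n ^ q * a ^ (k - 1)"
    using pos by (intro mult_right_mono mult_mono power_mono) auto
  also have "\<dots> = n ^ (2 * q - (k - 1)) * a ^ (k - 1)"
  proof -
    have "q - (k - 1) + q = 2 * q - (k - 1)" using k(2) by simp
    then show ?thesis by (simp only: power_add[symmetric])
  qed
  finally have "Q * 2 ^ (k + q + 1) * L ^ k * p ^ q \<le> Q * 2 ^ (k + q + 1) * L ^ k * (n ^ (2 * q - (k - 1)) * a ^ (k - 1))"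
    using pos by (intro mult_left_mono) auto
  then have "e ^ q * a ^ (k - 1) \<le> Q * 2 ^ (k + q + 1) * L ^ k * n ^ (2 * q - (k - 1)) * a ^ (k - 1)"
    using order_trans[OF *] by (simp only: mult.assoc)
  then show ?thesis
    using pos by (elim mult_right_le_imp_le) simp
qed

lemma density_inequality:
  fixes a b e L M Q n :: real
  assumes pos: "0 < a" "0 < b" "a \<le> n" "b \<le> n" "0 < e" "0 \<le> L" "0 \<le> Q" and k: "1 \<le> k" "k - 1 \<le> q"
    and lower: "(2 * a * b) ^ (2 * k) * (e / (2 * a * b)) ^ (k + q) \<le> M * (a * b) ^ k"
    and upper: "M \<le> Q * (a * (L * e / a) ^ k + b * (L * e / b) ^ k)"
  shows "e ^ q \<le> Q * 2 ^ (k + q + 1) * L ^ k * n ^ (2 * q - (k - 1))"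
proof (cases "a \<le> b")
  case True
  then show ?thesis using density_inequality_ordered[of a b n e L Q k q M] assms by simp
next
  case False
  have comm: "b * a = a * b" "2 * b * a = 2 * a * b" by simp_all
  have "(2 * b * a) ^ (2 * k) * (e / (2 * b * a)) ^ (k + q) \<le> M * (b * a) ^ k"
    using lower by (simp only: comm)
  moreover have "M \<le> Q * (b * (L * e / b) ^ k + a * (L * e / a) ^ k)"
    using upper by (simp only: add.commute)
  ultimately show ?thesis
    using pos False by (intro density_inequality_ordered[OF _ _ _ _ _ _ k]) auto
qed

section \<open>Hosts without a copy of \<open>H\<close>\<close>

definition free_of :: "'a graph \<Rightarrow> 'b graph \<Rightarrow> bool" where
  "free_of G H \<longleftrightarrow> \<not> (\<exists>F. subgraph F G \<and> isomorphic F H)"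

lemma free_of_subgraph:
  assumes "free_of G H" "verts G' \<subseteq> verts G" "edges G' \<subseteq> edges G"
  shows "free_of G' H"
  using assms unfolding free_of_def subgraph_def by blast

text \<open>An injective homomorphism makes the image graph, whose edges are exactly the images of
  the edges of \<open>H\<close>, a copy of \<open>H\<close>. The induced subgraph on the image could
  have further edges and fail to be isomorphic to \<open>H\<close>.\<close>

lemma free_of_homs_not_inj:
  assumes H: "simple_graph H" and G: "simple_graph G" and free: "free_of G H" and f: "f \<in> homs H G"
  shows "\<not> inj_on f (verts H)"
proof
  assume inj: "inj_on f (verts H)"
  let ?F = "\<lparr>verts = f ` verts H, edges = (`) f ` edges H\<rparr>"
  have sub: "subgraph ?F G"
  proof -
    have "f ` e \<subseteq> f ` verts H \<and> card (f ` e) = 2" if "e \<in> edges H" for e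
      using that H inj by (auto simp: simple_graph_def card_image inj_on_subset)
    then show ?thesis
      using f finite_verts[OF H] by (auto simp: subgraph_def simple_graph_def homs_def)
  qed
  let ?g = "the_inv_into (verts H) f"
  have g: "?g (f x) = x" if "x \<in> verts H" for x
    using inj that by (rule the_inv_into_f_f)
  have "is_graph_iso ?F H ?g"
  proof -
    have "bij_betw ?g (f ` verts H) (verts H)"
      using inj by (simp add: bij_betw_the_inv_into inj_on_imp_bij_betw)
    moreover have "{f x, f y} \<in> (`) f ` edges H \<longleftrightarrow> {x, y} \<in> edges H"
      if xy: "x \<in> verts H" "y \<in> verts H" for x y
    proof
      assume "{f x, f y} \<in> (`) f ` edges H"
      then obtain e where e: "e \<in> edges H" "f ` {x, y} = f ` e" by auto
      then have "{x, y} = e"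
        using inj_on_image_eq_iff[OF inj, of "{x, y}" e] xy H by (auto simp: simple_graph_def)
      then show "{x, y} \<in> edges H" using e by simp
    next
      assume "{x, y} \<in> edges H"
      then show "{f x, f y} \<in> (`) f ` edges H" by (intro image_eqI[of _ _ "{x, y}"]) auto
    qed
    ultimately show ?thesis
      using g by (auto simp: is_graph_iso_def)
  qed
  with sub free show False
    by (auto simp: free_of_def isomorphic_def)
qed

text \<open>For d-regular \<open>H\<close> with parts of size k, q stands for (d - 1)k. The number
  of homomorphisms is squeezed between Sidorenko's bound on the balanced blow-up and the star count
  supplied by reflectivity; L measures how far the degrees on each side may exceed their average.
  \<open>C\<close> depends on \<open>H\<close> only, hence is obtained before the host.\<close>

lemma bipartite_free_edge_bound:
  fixes H :: "'a graph"
  assumes H: "simple_graph H" "connected_graph H" and X: "bipartition H X\<^sub>1 X\<^sub>2"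
    and k: "card X\<^sub>1 = k" "card X\<^sub>2 = k" "1 \<le> k" "k - 1 \<le> q" and eH: "card (edges H) = k + q"
    and nb: "\<And>v. v \<in> verts H \<Longrightarrow> \<exists>u. {u, v} \<in> edges H"
    and reflective: "reflective H X\<^sub>1 X\<^sub>2" and sid: "sidorenko H"
  obtains C :: real where "C \<ge> 0"
    "\<And>(G :: nat graph) Y\<^sub>1 Y\<^sub>2 n L.
       simple_graph G \<Longrightarrow> bipartition G Y\<^sub>1 Y\<^sub>2 \<Longrightarrow> free_of G H \<Longrightarrow> edges G \<noteq> {} \<Longrightarrow>
       card (verts G) \<le> n \<Longrightarrow>
       (\<And>v. v \<in> Y\<^sub>1 \<Longrightarrow> card Y\<^sub>1 * card (nbrs G v) \<le> L * card (edges G)) \<Longrightarrow>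
       (\<And>v. v \<in> Y\<^sub>2 \<Longrightarrow> card Y\<^sub>2 * card (nbrs G v) \<le> L * card (edges G)) \<Longrightarrow>
       real (card (edges G)) ^ q \<le> C * real L ^ k * real n ^ (2 * q - (k - 1))"
proof -
  have X': "X\<^sub>1 \<union> X\<^sub>2 = verts H" "X\<^sub>1 \<inter> X\<^sub>2 = {}" "X\<^sub>1 \<noteq> {}" "X\<^sub>2 \<noteq> {}"
    using X k by (auto simp: bipartition_def)
  have diff: "verts H - X\<^sub>1 = X\<^sub>2" "verts H - X\<^sub>2 = X\<^sub>1"
    using X' by auto
  from reflective_homs_bound[OF H(1) X reflective] obtain Q where
    Q: "\<And>G :: nat graph. simple_graph G \<Longrightarrow> (\<forall>f\<in>homs H G. \<not> inj_on f X\<^sub>1 \<or> \<not> inj_on f X\<^sub>2) \<Longrightarrow>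
           card (homs H G) \<le> Q * (card (homs_const H G X\<^sub>1) + card (homs_const H G X\<^sub>2))"
    by blast
  show thesis
  \<comment> \<open>The 2 in \<open>2 * Q\<close> accounts for the two parts of \<open>H\<close>:
    the stars of either kind are bounded by the same sum of k-th powers of degrees.\<close>
  proof (rule that[of "real (2 * Q) * 2 ^ (k + q + 1)"])
    fix G :: "nat graph" and Y\<^sub>1 Y\<^sub>2 n L
    assume G: "simple_graph G" and Y: "bipartition G Y\<^sub>1 Y\<^sub>2" and free: "free_of G H"
      and ne: "edges G \<noteq> {}" and n: "card (verts G) \<le> n"
      and deg: "\<And>v. v \<in> Y\<^sub>1 \<Longrightarrow> card Y\<^sub>1 * card (nbrs G v) \<le> L * card (edges G)"
        "\<And>v. v \<in> Y\<^sub>2 \<Longrightarrow> card Y\<^sub>2 * card (nbrs G v) \<le> L * card (edges G)"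
    have Y': "Y\<^sub>1 \<union> Y\<^sub>2 = verts G" "Y\<^sub>1 \<inter> Y\<^sub>2 = {}"
      using Y by (auto simp: bipartition_def)
    have fin: "finite Y\<^sub>1" "finite Y\<^sub>2"
      using Y' finite_verts[OF G] by (metis finite_Un)+
    have "Y\<^sub>1 \<noteq> {}" "Y\<^sub>2 \<noteq> {}"
      using Y ne by (fastforce simp: bipartition_def)+
    then have pos: "0 < card Y\<^sub>1" "0 < card Y\<^sub>2" "0 < card (edges G)"
      using fin finite_edges[OF G] ne by (auto simp: card_gt_0_iff)
    have le: "card Y\<^sub>1 \<le> n" "card Y\<^sub>2 \<le> n"
      using Y' by (auto intro!: order_trans[OF card_mono[OF finite_verts[OF G]] n])
    have ninj: "\<not> inj_on f X\<^sub>1 \<or> \<not> inj_on f X\<^sub>2" if f: "f \<in> homs H G" for f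
    proof (rule ccontr)
      assume *: "\<not> ?thesis"
      have "f ` X\<^sub>1 \<inter> f ` X\<^sub>2 = {}"
        by (rule homs_bipartite_cases[OF H X Y f]) (use Y' in blast)+
      moreover have "X\<^sub>1 - X\<^sub>2 = X\<^sub>1" "X\<^sub>2 - X\<^sub>1 = X\<^sub>2"
        using X' by auto
      ultimately have "inj_on f (X\<^sub>1 \<union> X\<^sub>2)"
        using * unfolding inj_on_Un by simp
      then show False
        using free_of_homs_not_inj[OF H(1) G free f] X' by simp
    qed
    let ?e = "real (card (edges G))"
    let ?D = "\<Sum>y\<in>verts G. card (nbrs G y) ^ k"
    have side: "(\<Sum>y\<in>Y. real (card (nbrs G y)) ^ k) \<le> real (card Y) * (real L * ?e / real (card Y)) ^ k"
      if "0 < card Y" "\<And>v. v \<in> Y \<Longrightarrow> card Y * card (nbrs G v) \<le> L * card (edges G)" for Y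
    proof -
      have "(\<Sum>y\<in>Y. real (card (nbrs G y)) ^ k) \<le> (\<Sum>y\<in>Y. (real L * ?e / real (card Y)) ^ k)"
      proof (intro sum_mono power_mono)
        fix v assume "v \<in> Y"
        then have "real (card Y * card (nbrs G v)) \<le> real (L * card (edges G))"
          using that(2) of_nat_mono by blast
        then show "real (card (nbrs G v)) \<le> real L * ?e / real (card Y)"
          using that(1) by (simp add: field_simps)
      qed simp
      then show ?thesis by simp
    qed
    have "real ?D = (\<Sum>y\<in>Y\<^sub>1. real (card (nbrs G y)) ^ k) + (\<Sum>y\<in>Y\<^sub>2. real (card (nbrs G y)) ^ k)"
      using fin Y' by (simp add: sum.union_disjoint flip: Y'(1))
    then have D: "real ?D \<le> real (card Y\<^sub>1) * (real L * ?e / real (card Y\<^sub>1)) ^ k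
                    + real (card Y\<^sub>2) * (real L * ?e / real (card Y\<^sub>2)) ^ k"
      using side[of Y\<^sub>1] side[of Y\<^sub>2] deg pos by simp
    have nb1: "\<exists>x\<in>X\<^sub>1. {x, v} \<in> edges H" if "v \<in> verts H - X\<^sub>1" for v
      using nb[of v] bipartition_edgeD(1)[OF X] that by blast
    have nb2: "\<exists>x\<in>X\<^sub>2. {x, v} \<in> edges H" if "v \<in> verts H - X\<^sub>2" for v
      using nb[of v] bipartition_edgeD(1)[OF bipartition_commute[OF X]] that by blast
    have "card (homs_const H G X\<^sub>1) \<le> ?D"
      using card_homs_const_le[OF H(1) G X'(3) _ nb1] X' diff k by auto
    moreover have "card (homs_const H G X\<^sub>2) \<le> ?D"
      using card_homs_const_le[OF H(1) G X'(4) _ nb2] X' diff k by auto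
    ultimately have "card (homs_const H G X\<^sub>1) + card (homs_const H G X\<^sub>2) \<le> 2 * ?D"
      by linarith
    then have "Q * (card (homs_const H G X\<^sub>1) + card (homs_const H G X\<^sub>2)) \<le> Q * (2 * ?D)"
      by (rule mult_left_mono) simp
    then have "card (homs H G) \<le> (2 * Q) * ?D"
      using Q[OF G] ninj by (simp add: mult_ac order_trans)
    then have "real (card (homs H G)) \<le> real (2 * Q) * real ?D"
      by (metis of_nat_le_iff of_nat_mult)
    also have "\<dots> \<le> real (2 * Q) * (real (card Y\<^sub>1) * (real L * ?e / real (card Y\<^sub>1)) ^ k
                    + real (card Y\<^sub>2) * (real L * ?e / real (card Y\<^sub>2)) ^ k)"
      using D by (rule mult_left_mono) simp
    finally have upper: "real (card (homs H G)) \<le> real (2 * Q) * (real (card Y\<^sub>1) * (real L * ?e / real (card Y\<^sub>1)) ^ k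
                    + real (card Y\<^sub>2) * (real L * ?e / real (card Y\<^sub>2)) ^ k)" .
    have lower: "(2 * real (card Y\<^sub>1) * real (card Y\<^sub>2)) ^ (2 * k) *
        (?e / (2 * real (card Y\<^sub>1) * real (card Y\<^sub>2))) ^ (k + q)
        \<le> real (card (homs H G)) * (real (card Y\<^sub>1) * real (card Y\<^sub>2)) ^ k"
      using sidorenko_bipartite[OF H X k(1,2) sid G Y refl pos(1) refl pos(2)] eH by simp
    show "?e ^ q \<le> real (2 * Q) * 2 ^ (k + q + 1) * real L ^ k * real n ^ (2 * q - (k - 1))"
      by (rule density_inequality[OF _ _ _ _ _ _ _ k(3,4) lower upper]) (use pos le in auto)
  qed simp
qed

text \<open>N is the integer part of the binary logarithm of n, plus one. The bound ln n \<le>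
  n^\<delta> / \<delta> produces the second summand of the constant, and the 1 absorbs the rounding
  because n^\<delta> \<ge> 1.\<close>

lemma log_le_powr:
  fixes \<delta> :: real
  assumes "\<delta> > 0"
  obtains K :: real where "K > 0"
    "\<And>n. 1 \<le> n \<Longrightarrow> \<exists>N::nat. n < 2 ^ N \<and> real N \<le> K * real n powr \<delta>"
proof
  let ?K = "1 + 1 / (\<delta> * ln 2)"
  show "?K > 0" using assms by (simp add: add_pos_pos)
  fix n :: nat assume n: "1 \<le> n"
  then obtain j where j: "2 ^ j \<le> n" "n < 2 ^ (j + 1)"
    using ex_power_ivl1[of 2 n] by auto
  have "real (2 ^ j) \<le> real n" using j(1) by (rule of_nat_mono)
  then have le: "(2::real) ^ j \<le> real n" by simp
  have "real j * ln 2 = ln (2 ^ j)" by (simp add: ln_realpow)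
  also have "\<dots> \<le> ln (real n)"
    using le n by (subst ln_le_cancel_iff) auto
  also have "\<dots> \<le> real n powr \<delta> / \<delta>"
    using n assms by (intro ln_powr_bound) auto
  finally have "real j \<le> real n powr \<delta> / \<delta> / ln 2"
    by (subst pos_le_divide_eq) simp_all
  moreover have "1 \<le> real n powr \<delta>"
    using n assms by (simp add: ge_one_powr_ge_zero)
  ultimately have "real (j + 1) \<le> ?K * real n powr \<delta>"
    by (simp add: algebra_simps)
  then show "\<exists>N::nat. n < 2 ^ N \<and> real N \<le> ?K * real n powr \<delta>"
    using j(2) by blast
qed

text \<open>Edges are counted from either side; for d > 0 the two formulas force the parts to have
  equal size.\<close>

lemma regular_bipartite_card:
  assumes H: "simple_graph H" and X: "bipartition H X\<^sub>1 X\<^sub>2" and reg: "regular_graph H d"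
  shows "card (edges H) = d * card X\<^sub>1" "card (edges H) = d * card X\<^sub>2"
proof -
  have "card (nbrs H v) = d" if "v \<in> X\<^sub>1 \<union> X\<^sub>2" for v
    using that X reg by (auto simp: bipartition_def regular_graph_def)
  then have "(\<Sum>v\<in>X\<^sub>1. card (nbrs H v)) = (\<Sum>v\<in>X\<^sub>1. d)" "(\<Sum>v\<in>X\<^sub>2. card (nbrs H v)) = (\<Sum>v\<in>X\<^sub>2. d)"
    by (simp_all cong: sum.cong)
  then show "card (edges H) = d * card X\<^sub>1" "card (edges H) = d * card X\<^sub>2"
    using card_edges_bipartite[OF H X] card_edges_bipartite[OF H bipartition_commute[OF X]]
    by (simp_all add: mult.commute)
qed

text \<open>A walk can only go back and forth along one edge, so \<open>H\<close> is a single edge.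
  This excludes d = 1, for which q = (d - 1)k would be 0 and a bound on e^q would say
  nothing.\<close>

lemma connected_one_regular:
  assumes H: "simple_graph H" "connected_graph H" and reg: "regular_graph H 1"
  shows "card (verts H) \<le> 2"
proof -
  obtain u where u: "u \<in> verts H" using H(2) by (auto simp: connected_graph_def)
  then obtain v where v: "nbrs H u = {v}"
    using reg by (auto simp: regular_graph_def card_1_singleton_iff)
  then have "{v, u} \<in> edges H" by blast
  then have "v \<in> verts H" "u \<in> nbrs H v"
    using simple_graph_edgeD[OF H(1)] by (auto simp: insert_commute)
  moreover obtain x where "nbrs H v = {x}"
    using reg \<open>v \<in> verts H\<close> by (auto simp: regular_graph_def card_1_singleton_iff)
  ultimately have v': "nbrs H v = {u}" by simp
  have "w \<in> {u, v}" if "(u, w) \<in> {(x, y). {x, y} \<in> edges H}\<^sup>*" for w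
    using that
  proof induction
    case (step y z)
    then have "z \<in> nbrs H y" by (simp add: insert_commute)
    then show ?case using step.IH v v' by auto
  qed simp
  then have "verts H \<subseteq> {u, v}"
    using H(2) u by (auto simp: connected_graph_def)
  then have "card (verts H) \<le> card {u, v}" by (intro card_mono) auto
  also have "\<dots> \<le> 2" by (simp add: card_insert_if)
  finally show ?thesis .
qed

text \<open>Every nonempty host contains the one-vertex graph, so no host qualifies and
  \<open>Max\<close> is applied to the empty set for every n \<ge> 1.\<close>

lemma turan_ex_no_edge:
  assumes "verts H = {v}" "edges H = {}" "n \<ge> 1"
  shows "turan_ex n H = Max {}"
proof -
  have "\<exists>F. subgraph F G \<and> isomorphic F H" if G: "simple_graph G" "card (verts G) = n" for G :: "nat graph"
  proof -
    obtain x where x: "x \<in> verts G" using G assms(3) by fastforce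
    let ?F = "\<lparr>verts = {x}, edges = {}\<rparr>"
    have "subgraph ?F G" using x by (auto simp: subgraph_def simple_graph_def)
    moreover have "is_graph_iso ?F H (\<lambda>_. v)"
      using assms by (auto simp: is_graph_iso_def bij_betw_def)
    ultimately show ?thesis by (auto simp: isomorphic_def)
  qed
  then have "{card (edges G) | G :: nat graph.
     simple_graph G \<and> card (verts G) = n \<and> \<not> (\<exists>F. subgraph F G \<and> isomorphic F H)} = {}"
    by blast
  then show ?thesis by (simp only: turan_ex_def)
qed

text \<open>An arbitrary host is reduced to an almost regular bipartite one. The cut costs a factor
  2 and the regularisation N^2, which becomes N^(2q) in the q-th power; the degree ratio L = 2N adds
  N^k. This explains the exponent 2q + k, N being the number of dyadic scales.\<close>

lemma free_edge_bound:
  fixes H :: "'a graph"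
  assumes H: "simple_graph H" "connected_graph H" and X: "bipartition H X\<^sub>1 X\<^sub>2"
    and k: "card X\<^sub>1 = k" "card X\<^sub>2 = k" "1 \<le> k" "k - 1 \<le> q" and eH: "card (edges H) = k + q"
    and nb: "\<And>v. v \<in> verts H \<Longrightarrow> \<exists>u. {u, v} \<in> edges H"
    and reflective: "reflective H X\<^sub>1 X\<^sub>2" and sid: "sidorenko H"
  obtains C :: real where "C \<ge> 0"
    "\<And>(G :: nat graph) N. simple_graph G \<Longrightarrow> free_of G H \<Longrightarrow> card (verts G) < 2 ^ N \<Longrightarrow> 1 \<le> q \<Longrightarrow>
       real (card (edges G)) ^ q \<le> C * real N ^ (2 * q + k) * real (card (verts G)) ^ (2 * q - (k - 1))"
proof -
  obtain C :: real where C: "C \<ge> 0"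
    and bound: "\<And>(G :: nat graph) Y\<^sub>1 Y\<^sub>2 n L.
       simple_graph G \<Longrightarrow> bipartition G Y\<^sub>1 Y\<^sub>2 \<Longrightarrow> free_of G H \<Longrightarrow> edges G \<noteq> {} \<Longrightarrow>
       card (verts G) \<le> n \<Longrightarrow>
       (\<And>v. v \<in> Y\<^sub>1 \<Longrightarrow> card Y\<^sub>1 * card (nbrs G v) \<le> L * card (edges G)) \<Longrightarrow>
       (\<And>v. v \<in> Y\<^sub>2 \<Longrightarrow> card Y\<^sub>2 * card (nbrs G v) \<le> L * card (edges G)) \<Longrightarrow>
       real (card (edges G)) ^ q \<le> C * real L ^ k * real n ^ (2 * q - (k - 1))"
    using bipartite_free_edge_bound[OF H X k eH nb reflective sid] by blast
  show thesis
  proof (rule that[of "2 ^ q * C * 2 ^ k"])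
    fix G :: "nat graph" and N
    assume G: "simple_graph G" and free: "free_of G H" and N: "card (verts G) < 2 ^ N" and q: "1 \<le> q"
    let ?e = "card (edges G)" and ?n = "card (verts G)"
    show "real ?e ^ q \<le> 2 ^ q * C * 2 ^ k * real N ^ (2 * q + k) * real ?n ^ (2 * q - (k - 1))"
    proof (cases "?e = 0")
      case True
      then show ?thesis using q C by (simp add: power_0_left)
    next
      case False
      have "\<exists>Y\<subseteq>verts G. ?e \<le> 2 * card {e \<in> edges G. \<exists>x\<in>Y. \<exists>y\<in>verts G - Y. e = {x, y}}"
        by (rule exists_large_cut) (use G in \<open>auto simp: simple_graph_def\<close>)
      then obtain Y where Y: "Y \<subseteq> verts G"
        "?e \<le> 2 * card {e \<in> edges G. \<exists>x\<in>Y. \<exists>y\<in>verts G - Y. e = {x, y}}"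
        by blast
      have disj: "Y \<inter> (verts G - Y) = {}" by blast
      note G1 = bip_subgraph[OF G Y(1) Diff_subset disj]
      let ?G1 = "bip_subgraph G Y (verts G - Y)"
      have "verts ?G1 = verts G" using Y(1) by (auto simp: bip_subgraph_def)
      then have "card (verts ?G1) < 2 ^ N" using N by simp
      from exists_almost_regular_subgraph[OF G1(1,2) this] obtain S T where
        ST: "S \<subseteq> Y" "T \<subseteq> verts G - Y"
        and le: "card (edges ?G1) \<le> N ^ 2 * card (edges (bip_subgraph ?G1 S T))"
        and deg: "\<And>v. v \<in> S \<Longrightarrow> card S * card (nbrs (bip_subgraph ?G1 S T) v)
                     \<le> 2 * N * card (edges (bip_subgraph ?G1 S T))"
          "\<And>v. v \<in> T \<Longrightarrow> card T * card (nbrs (bip_subgraph ?G1 S T) v)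
                     \<le> 2 * N * card (edges (bip_subgraph ?G1 S T))"
        by blast
      let ?B = "bip_subgraph ?G1 S T"
      have ST': "S \<subseteq> verts ?G1" "T \<subseteq> verts ?G1" "S \<inter> T = {}"
        using ST Y(1) by (auto simp: bip_subgraph_def)
      note B = bip_subgraph[OF G1(1) ST']
      have vB: "verts ?B \<subseteq> verts G" and eB: "edges ?B \<subseteq> edges G"
        using B(3,4) G1(3,4) by auto
      have "?e \<le> 2 * card (edges ?G1)" using Y(2) by (simp add: bip_subgraph_def)
      then have e_le: "?e \<le> 2 * N ^ 2 * card (edges ?B)" using le by simp
      then have "edges ?B \<noteq> {}" using False by auto
      moreover have "free_of ?B H" using free_of_subgraph[OF free vB eB] .
      moreover have "card (verts ?B) \<le> ?n" using vB finite_verts[OF G] by (simp add: card_mono)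
      ultimately have eBq: "real (card (edges ?B)) ^ q \<le> C * real (2 * N) ^ k * real ?n ^ (2 * q - (k - 1))"
        using bound[OF B(1,2) _ _ _ deg] by blast
      have "real ?e ^ q \<le> real (2 * N ^ 2 * card (edges ?B)) ^ q"
        using e_le by (intro power_mono of_nat_mono) auto
      also have "\<dots> = 2 ^ q * real N ^ (2 * q) * real (card (edges ?B)) ^ q"
        by (simp add: power_mult_distrib power_mult)
      also have "\<dots> \<le> 2 ^ q * real N ^ (2 * q) * (C * real (2 * N) ^ k * real ?n ^ (2 * q - (k - 1)))"
        using eBq by (rule mult_left_mono) simp
      also have "\<dots> = 2 ^ q * C * 2 ^ k * real N ^ (2 * q + k) * real ?n ^ (2 * q - (k - 1))"
        by (simp add: power_add power_mult_distrib)
      finally show ?thesis .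
    qed
  qed (use C in simp)
qed

theorem theorem2p17:
  fixes H :: "'a graph" and X\<^sub>1 X\<^sub>2 :: "'a set" and d :: nat
  assumes "simple_graph H"
    and "connected_graph H"
    and "bipartition H X\<^sub>1 X\<^sub>2"
    and "regular_graph H d"
    and "reflective H X\<^sub>1 X\<^sub>2"
    and "sidorenko H"
    and "\<not> isomorphic H (complete_bipartite d d)"
  shows "\<exists>\<epsilon> > (0::real). \<exists>C > (0::real). \<forall>n::nat. n \<ge> 1 \<longrightarrow>
           real (turan_ex n H) \<le> C * real n powr (2 - 1 / real d - \<epsilon>)"
proof -
  note H = assms(1) and conn = assms(2) and X = assms(3) and reg = assms(4)
  have X': "X\<^sub>1 \<union> X\<^sub>2 = verts H" "X\<^sub>1 \<inter> X\<^sub>2 = {}"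
    using X by (auto simp: bipartition_def)
  have fin: "finite X\<^sub>1" "finite X\<^sub>2"
    using X' finite_verts[OF H] by (metis finite_Un)+
  note eH = regular_bipartite_card[OF H X reg]
  show ?thesis
  proof (cases "d = 0")
    case True
    \<comment> \<open>\<open>H\<close> is a single vertex, so \<open>turan_ex n H\<close> is the unspecified value \<open>Max {}\<close>, which does not
      depend on \<open>n\<close>.\<close>
    then have noedge: "edges H = {}" using eH finite_edges[OF H] by simp
    obtain v where v: "v \<in> verts H" using conn by (auto simp: connected_graph_def)
    have "w = v" if "w \<in> verts H" for w
    proof -
      have "(v, w) \<in> {(x, y). {x, y} \<in> edges H}\<^sup>*"
        using conn v that unfolding connected_graph_def by blast
      then show ?thesis by (simp add: noedge)
    qed
    then have "verts H = {v}" using v by blast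
    then have "turan_ex n H = Max {}" if "n \<ge> 1" for n
      using turan_ex_no_edge noedge that by metis
    then obtain m where T: "\<And>n. n \<ge> 1 \<Longrightarrow> turan_ex n H = m"
      by blast
    \<comment> \<open>With d = 0 the term \<open>1 / real d\<close> is 0, so the choice \<epsilon> =
      1 leaves the exponent 1, and a linear function dominates the constant m.\<close>
    have "real (turan_ex n H) \<le> (real m + 1) * real n powr (2 - 1 / real d - 1)" if n: "n \<ge> 1" for n
    proof -
      have "real m * 1 \<le> (real m + 1) * real n"
        using n by (intro mult_mono) auto
      then show ?thesis using T[OF n] True n by simp
    qed
    then show ?thesis
      by (intro exI[of _ 1] conjI exI[of _ "real m + 1"]) auto
  next
    case False
    define k where "k = card X\<^sub>1"
    \<comment> \<open>The number of edges of \<open>H\<close> beyond k: Sidorenko's bound involves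
      e^(k+q), the star count e^k, and e^q survives the comparison.\<close>
    define q where "q = (d - 1) * k"
    have k: "card X\<^sub>1 = k" "card X\<^sub>2 = k"
      using eH False by (auto simp: k_def)
    have cV: "card (verts H) = 2 * k"
      using fin X' k by (simp add: card_Un_disjoint flip: X'(1))
    moreover have "verts H \<noteq> {}" using conn by (simp add: connected_graph_def)
    ultimately have k1: "1 \<le> k" using finite_verts[OF H] by (cases k) auto
    then obtain x where x: "x \<in> X\<^sub>1" using k(1) by fastforce
    have "nbrs H x \<subseteq> X\<^sub>2"
      using bipartition_edgeD(2)[OF bipartition_commute[OF X]] x X' by blast
    then have "card (nbrs H x) \<le> k"
      using card_mono[OF fin(2)] k(2) by blast
    moreover have "x \<in> verts H" using x X' by blast
    ultimately have "d \<le> k" using reg by (auto simp: regular_graph_def)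
    moreover have "d \<noteq> k"
      using isomorphic_complete_bipartite[OF H X reg] k assms(7) by auto
    ultimately have dk: "d < k" by simp
    have "d \<noteq> 1"
    proof
      assume "d = 1"
      then show False using connected_one_regular[OF H conn] reg cV dk by simp
    qed
    with False have d2: "2 \<le> d" by simp
    then obtain j where "d = Suc (Suc j)" by (metis add_2_eq_Suc le_Suc_ex)
    then have q: "k \<le> q" "k + q = d * k" by (simp_all add: q_def)
    have rq: "real q = (real d - 1) * real k" using d2 by (simp add: q_def of_nat_diff)
    have nb: "\<exists>u. {u, v} \<in> edges H" if "v \<in> verts H" for v
    proof -
      have "card (nbrs H v) = d" using reg that by (simp add: regular_graph_def)
      then have "nbrs H v \<noteq> {}" using False by (metis card.empty)
      then show ?thesis by blast
    qed
    have "k - 1 \<le> q" "card (edges H) = k + q" using q eH k by auto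
    from free_edge_bound[OF H conn X k k1 this nb assms(5,6)] obtain C :: real where C: "C \<ge> 0"
      and bound: "\<And>(G :: nat graph) N. simple_graph G \<Longrightarrow> free_of G H \<Longrightarrow> card (verts G) < 2 ^ N \<Longrightarrow> 1 \<le> q \<Longrightarrow>
       real (card (edges G)) ^ q \<le> C * real N ^ (2 * q + k) * real (card (verts G)) ^ (2 * q - (k - 1))"
      by blast
    \<comment> \<open>Half of the gap between (k - 1)/q and 1/d: the counting argument gains the
      whole gap, and the other half pays for the logarithmic factors.\<close>
    define \<epsilon> where "\<epsilon> = ((real k - 1) / real q - 1 / real d) / 2"
    \<comment> \<open>Chosen so that N^(2q+k), with N at most of order n^\<delta>, costs
      n^(\<epsilon> q), that is n^\<epsilon> after taking q-th roots.\<close>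
    define \<delta> where "\<delta> = \<epsilon> * real q / real (2 * q + k)"
    have q0: "0 < real q" using q k1 by simp
    \<comment> \<open>As q = (d - 1)k, this is d < k rearranged; it is what makes \<epsilon>
      positive.\<close>
    have "real q < real d * (real k - 1)"
      using dk rq by (simp add: algebra_simps)
    then have "1 / real d < (real k - 1) / real q"
      using q0 d2 by (simp add: field_simps)
    then have \<epsilon>: "0 < \<epsilon>" by (simp add: \<epsilon>_def)
    then have \<delta>: "0 < \<delta>" using q0 by (simp add: \<delta>_def)
    obtain K :: real where K: "K > 0"
      "\<And>n. 1 \<le> n \<Longrightarrow> \<exists>N::nat. n < 2 ^ N \<and> real N \<le> K * real n powr \<delta>"
      using log_le_powr[OF \<delta>] by blast
    \<comment> \<open>The added 1 ensures D \<ge> 1, so that the constant is at most D^q and the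
      q-th root needs no fractional power of it.\<close>
    define D where "D = C * K ^ (2 * q + k) + 1"
    have D: "1 \<le> D" using C K(1) by (simp add: D_def)
    have "real (card (edges G)) \<le> D * real n powr (2 - 1 / real d - \<epsilon>)"
      if G: "simple_graph G" "card (verts G) = n" "\<not> (\<exists>F. subgraph F G \<and> isomorphic F H)" and n: "n \<ge> 1"
      for G :: "nat graph" and n
    proof -
      obtain N where N: "n < 2 ^ N" "real N \<le> K * real n powr \<delta>" using K(2)[OF n] by blast
      let ?s = "2 - 1 / real d - \<epsilon>"
      have exps: "\<delta> * real (2 * q + k) + real (2 * q - (k - 1)) = ?s * real q"
      proof -
        have "\<delta> * real (2 * q + k) = \<epsilon> * real q" using q0 by (simp add: \<delta>_def)
        moreover have "real (2 * q - (k - 1)) = 2 * real q - (real k - 1)"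
          using q k1 by (simp add: of_nat_diff)
        moreover have "real k - 1 = (2 * \<epsilon> + 1 / real d) * real q"
        proof -
          have "2 * \<epsilon> + 1 / real d = (real k - 1) / real q" 
            using q0 d2 by (simp add: \<epsilon>_def field_simps)
          then show ?thesis using q0 by simp
        qed
        ultimately show ?thesis by (simp add: algebra_simps)
      qed
      have "real (card (edges G)) ^ q \<le> C * real N ^ (2 * q + k) * real n ^ (2 * q - (k - 1))"
        using bound[of G N] G N(1) q k1 by (simp add: free_of_def)
      also have "\<dots> \<le> C * (K * real n powr \<delta>) ^ (2 * q + k) * real n ^ (2 * q - (k - 1))"
        using N(2) C by (intro mult_right_mono mult_left_mono power_mono) auto
      also have "\<dots> = C * K ^ (2 * q + k) * (real n powr (\<delta> * real (2 * q + k)) * real n powr real (2 * q - (k - 1)))"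
        using n by (simp add: power_mult_distrib powr_power powr_realpow mult.commute)
      also have "\<dots> = C * K ^ (2 * q + k) * real n powr (?s * real q)"
        by (simp only: exps powr_add[symmetric])
      also have "\<dots> \<le> D ^ q * real n powr (?s * real q)"
      proof (rule mult_right_mono)
        have "C * K ^ (2 * q + k) \<le> D ^ 1" by (simp add: D_def)
        also have "\<dots> \<le> D ^ q" using D q k1 by (intro power_increasing) auto
        finally show "C * K ^ (2 * q + k) \<le> D ^ q" .
      qed simp
      also have "\<dots> = (D * real n powr ?s) ^ q"
        using n by (simp add: power_mult_distrib powr_power mult.commute)
      \<comment> \<open>\<open>power_le_imp_le_base\<close> takes roots for exponents of the form
        \<open>Suc\<close>; as q \<ge> 1, q equals \<open>Suc (q - 1)\<close>.\<close>
      finally have "real (card (edges G)) ^ Suc (q - 1) \<le> (D * real n powr ?s) ^ Suc (q - 1)"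
        using q k1 by simp
      then show ?thesis
        by (rule power_le_imp_le_base) (use D in simp)
    qed
    moreover have "edges H \<noteq> {}" using nb x X' by blast
    ultimately have "\<forall>n\<ge>1. real (turan_ex n H) \<le> D * real n powr (2 - 1 / real d - \<epsilon>)"
      using turan_ex_le[OF _ _ H] by blast
    then show ?thesis using \<epsilon> D by (intro exI[of _ \<epsilon>] conjI exI[of _ D]) auto
  qed
qed

end
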